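(* Let $\Gamma$ be a Carleson Jordan curve, let $t_1,\dots,t_n\in\Gamma$ be pairwise distinct points, let $w_1,\dots,w_n\in\mathbb{W}$, and let $w(\tau)=\prod_{k=1}^n w_k(|\tau-t_k|)$, $\tau\in\Gamma$. Then for every $t\in\Gamma$ the function $V_t^0w$ is regular and submultiplicative, and \[ \alpha(V_{t_k}^0w)=m(w_k),\quad \beta(V_{t_k}^0w)=M(w_k)\quad\text{for } k\in\{1,\dots,n\}, \] \[ \alpha(V_t^0w)=0,\quad\beta(V_t^0w)=0\quad\text{for } t\in\Gamma\setminus\{t_1,\dots,t_n\}. \]
   Context: **Curves.** A Jordan curve $\Gamma\subset\mathbb{C}$ is a curve homeomorphic to a circle; it is assumed rectifiable and equipped with Lebesgue length measure $|d\tau|$. $|\Omega|$ denotes the length measure of a measurable $\Omega\subset\Gamma$, $\Gamma(t,R):=\{\tau\in\Gamma:|\tau-t|<R\}$, and $d_t:=\max_{\tau\in\Gamma}|\tau-t|$. $\Gamma$ is a Carleson curve if $\sup_{t\in\Gamma}\sup_{R>0}|\Gamma(t,R)|/R<\infty$. **The class $\mathbb{W}$.** $W$ is the class of all continuous functions $\varrho:[0,|\Gamma|]\to[0,\infty)$ with $\varrho(0)=0$, $\varrho(x)>0$ for $0<x\le|\Gamma|$, and $\varrho$ almost increasing, i.e. there is $C>0$ with $\varrho(x)\le C\varrho(y)$ whenever $x\le y$. $\mathbb{W}$ is the set of all $\varrho:[0,|\Gamma|]\to[0,\infty]$ such that $x^\alpha\varrho(x)\in W$ and $x^\beta/\varrho(x)\in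 W$ for some $\alpha,\beta\in\mathbb{R}$ (values of these products at $x=0$ are understood as limits as $x\to 0$, so that e.g. $x^\gamma\in\mathbb{W}$ for all $\gamma\in\mathbb{R}$). **Matuszewska–Orlicz indices.** For $\varrho\in\mathbb{W}$ put $\Phi_\varrho^0(x):=\limsup_{y\to0}\varrho(xy)/\varrho(y)$, $x\in(0,\infty)$, and $m(\varrho):=\lim_{x\to0}\log\Phi_\varrho^0(x)/\log x$, $M(\varrho):=\lim_{x\to\infty}\log\Phi_\varrho^0(x)/\log x$; these limits exist and are finite. **Submultiplicative functions.** A function $\Phi:(0,\infty)\to(0,\infty]$ is regular if it is bounded in an open neighborhood of $1$, and submultiplicative if $\Phi(xy)\le\Phi(x)\Phi(y)$ for all $x,y\in(0,\infty)$. A regular submultiplicative function is finite everywhere, and its lower and upper indices are \[ \alpha(\Phi):=\sup_{x\in(0,1)}\frac{\log\Phi(x)}{\log x}=\lim_{x\to0}\frac{\log\Phi(x)}{\log x},\qquad \beta(\Phi):=\inf_{x\in(1,\infty)}\frac{\log\Phi(x)}{\log x}=\lim_{x\to\infty}\frac{\log\Phi(x)}{\log x}. \] **The function $V_t^0\psi$.** A weight is a measurable function $\psi:\Gamma\to[0,\infty]$ with $0<\psi<\infty$ a.e. For $t\in\Gamma$ and a weight $\psi$ on $\Gamma$ with $\log\psi\in L^1(\Gamma(t,R))$ for every $R\in(0,d_t]$, put \[ H_{\psi,t}(R_1,R_2):=\frac{\exp\left(\frac1{|\Gamma(t,R_1)|}\int_{\Gamma(t,R_1)}\log\psi(\tau)|d\tau|\right)}{\exp\left(\frac1{|\Gamma(t,R_2)|}\int_{\Gamma(t,R_2)}\log\psi(\tau)|d\tau|\right)},\quad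 R_1,R_2\in(0,d_t], \] and $(V_t^0\psi)(x):=\limsup_{R\to0}H_{\psi,t}(xR,R)$, $x\in(0,\infty)$. *)

theory Defs
  imports "HOL-Analysis.Analysis"
begin

text \<open>
  A Jordan curve is represented by an arbitrary parametrization \<open>\<gamma>\<close> over \<open>[0,1]\<close>; the curve
  \<open>\<Gamma>\<close> itself is \<open>path_image \<gamma>\<close>.
\<close>

definition Jordan_curve :: "(real \<Rightarrow> complex) \<Rightarrow> bool" where
  "Jordan_curve \<gamma> \<longleftrightarrow> simple_path \<gamma> \<and> pathfinish \<gamma> = pathstart \<gamma>"

text \<open>
  The supremum of the lengths of polygonal chains with vertices \<open>\<gamma> (p 0), \<dots>, \<gamma> (p n)\<close>,
  where the parameters \<open>p i \<in> S\<close> increase with \<open>i\<close>; it is \<open>0\<close> for empty \<open>S\<close>.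
\<close>

definition variation_on :: "(real \<Rightarrow> complex) \<Rightarrow> real set \<Rightarrow> ennreal" where
  "variation_on \<gamma> S =
     (SUP (n, p) \<in> {(n :: nat, p :: nat \<Rightarrow> real). mono_on {..n} p \<and> p ` {..n} \<subseteq> S}.
        \<Sum>i<n. ennreal (dist (\<gamma> (p i)) (\<gamma> (p (Suc i)))))"

definition rectifiable :: "(real \<Rightarrow> complex) \<Rightarrow> bool" where
  "rectifiable \<gamma> \<longleftrightarrow> variation_on \<gamma> {0..1} < \<infinity>"

definition arclength :: "(real \<Rightarrow> complex) \<Rightarrow> real \<Rightarrow> real" where
  "arclength \<gamma> x = enn2real (variation_on \<gamma> ({0..1} \<inter> {..x}))"

text \<open>
  The Lebesgue length measure \<open>|d\<tau>|\<close> on \<open>\<Gamma>\<close>: the image under \<open>\<gamma>\<close> of the Lebesgue--Stieltjes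
  measure of the arc length function (which is \<open>0\<close> to the left of \<open>0\<close> and constant to the right
  of \<open>1\<close>), completed.
\<close>

definition length_measure :: "(real \<Rightarrow> complex) \<Rightarrow> complex measure" where
  "length_measure \<gamma> =
     completion (distr (restrict_space (interval_measure (arclength \<gamma>)) {0..1})
                       (restrict_space borel (path_image \<gamma>)) \<gamma>)"

definition curve_length :: "(real \<Rightarrow> complex) \<Rightarrow> real" where
  "curve_length \<gamma> = measure (length_measure \<gamma>) (path_image \<gamma>)"

definition portion :: "(real \<Rightarrow> complex) \<Rightarrow> complex \<Rightarrow> real \<Rightarrow> complex set" where
  "portion \<gamma> t R = {\<tau> \<in> path_image \<gamma>. cmod (\<tau> - t) < R}"

definition max_dist :: "(real \<Rightarrow> complex) \<Rightarrow> complex \<Rightarrow> real" where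
  "max_dist \<gamma> t = (SUP \<tau> \<in> path_image \<gamma>. cmod (\<tau> - t))"

definition Carleson :: "(real \<Rightarrow> complex) \<Rightarrow> bool" where
  "Carleson \<gamma> \<longleftrightarrow>
     (SUP t \<in> path_image \<gamma>. SUP R \<in> {0<..}.
        emeasure (length_measure \<gamma>) (portion \<gamma> t R) / ennreal R) < \<infinity>"


definition almost_increasing_on :: "real set \<Rightarrow> (real \<Rightarrow> real) \<Rightarrow> bool" where
  "almost_increasing_on S f \<longleftrightarrow> (\<exists>C>0. \<forall>x\<in>S. \<forall>y\<in>S. x \<le> y \<longrightarrow> f x \<le> C * f y)"

text \<open>The parameter \<open>l\<close> stands for the length \<open>|\<Gamma>|\<close> of the curve.\<close>

definition class_W :: "real \<Rightarrow> (real \<Rightarrow> real) set" where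
  "class_W l = {f. continuous_on {0..l} f \<and> f 0 = 0 \<and> (\<forall>x\<in>{0<..l}. f x > 0) \<and>
                   almost_increasing_on {0..l} f}"

text \<open>
  Below, \<open>f\<close> and \<open>g\<close> are the functions \<open>x powr \<alpha> * \<rho> x\<close> and \<open>x powr \<beta> / \<rho> x\<close>, where the value at
  \<open>x = 0\<close> is understood as the limit for \<open>x \<rightarrow> 0\<close>; being continuous on \<open>[0,l]\<close>, they
  are determined by their values on \<open>(0,l]\<close>.
\<close>

definition class_WW :: "real \<Rightarrow> (real \<Rightarrow> ennreal) set" where
  "class_WW l = {\<rho>. \<exists>\<alpha> \<beta> :: real.
     (\<exists>f \<in> class_W l. \<forall>x\<in>{0<..l}. ennreal (f x) = ennreal (x powr \<alpha>) * \<rho> x) \<and>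
     (\<exists>g \<in> class_W l. \<forall>x\<in>{0<..l}. ennreal (g x) = ennreal (x powr \<beta>) / \<rho> x)}"

definition Phi0 :: "(real \<Rightarrow> ennreal) \<Rightarrow> real \<Rightarrow> ennreal" where
  "Phi0 \<rho> x = Limsup (at_right 0) (\<lambda>y. \<rho> (x * y) / \<rho> y)"

text \<open>
  The functions whose indices are considered here take values in \<open>(0,\<infinity>)\<close>, so that \<open>enn2real\<close>
  loses no information inside \<open>ln\<close>.
\<close>

definition log_ratio :: "(real \<Rightarrow> ennreal) \<Rightarrow> real \<Rightarrow> real" where
  "log_ratio \<Phi> x = ln (enn2real (\<Phi> x)) / ln x"

definition MO_lower_index :: "(real \<Rightarrow> ennreal) \<Rightarrow> real" where
  "MO_lower_index \<rho> = Lim (at_right 0) (log_ratio (Phi0 \<rho>))"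

definition MO_upper_index :: "(real \<Rightarrow> ennreal) \<Rightarrow> real" where
  "MO_upper_index \<rho> = Lim at_top (log_ratio (Phi0 \<rho>))"


text \<open>
  Functions \<open>(0,\<infinity>) \<rightarrow> (0,\<infinity>]\<close> are represented by functions \<open>real \<Rightarrow> ennreal\<close> whose values at
  nonpositive arguments are irrelevant.
\<close>

definition regular :: "(real \<Rightarrow> ennreal) \<Rightarrow> bool" where
  "regular \<Phi> \<longleftrightarrow> (\<forall>x>0. 0 < \<Phi> x) \<and>
     (\<exists>U (C :: real). open U \<and> 1 \<in> U \<and> U \<subseteq> {0<..} \<and> (\<forall>x\<in>U. \<Phi> x \<le> ennreal C))"

definition submultiplicative :: "(real \<Rightarrow> ennreal) \<Rightarrow> bool" where
  "submultiplicative \<Phi> \<longleftrightarrow> (\<forall>x>0. 0 < \<Phi> x) \<and> (\<forall>x>0. \<forall>y>0. \<Phi> (x * y) \<le> \<Phi> x * \<Phi> y)"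

text \<open>For regular submultiplicative functions the following supremum and infimum are finite.\<close>

definition lower_index :: "(real \<Rightarrow> ennreal) \<Rightarrow> real" where
  "lower_index \<Phi> = (SUP x \<in> {0<..<1}. log_ratio \<Phi> x)"

definition upper_index :: "(real \<Rightarrow> ennreal) \<Rightarrow> real" where
  "upper_index \<Phi> = (INF x \<in> {1<..}. log_ratio \<Phi> x)"


definition weight :: "(real \<Rightarrow> complex) \<Rightarrow> (complex \<Rightarrow> ennreal) \<Rightarrow> bool" where
  "weight \<gamma> \<psi> \<longleftrightarrow> \<psi> \<in> borel_measurable (length_measure \<gamma>) \<and>
     (AE \<tau> in length_measure \<gamma>. 0 < \<psi> \<tau> \<and> \<psi> \<tau> < \<infinity>)"

definition log_fun :: "(complex \<Rightarrow> ennreal) \<Rightarrow> complex \<Rightarrow> real" where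
  "log_fun \<psi> \<tau> = ln (enn2real (\<psi> \<tau>))"

text \<open>The condition under which the function \<open>V0\<close> below is defined.\<close>

definition log_integrable_weight :: "(real \<Rightarrow> complex) \<Rightarrow> (complex \<Rightarrow> ennreal) \<Rightarrow> complex \<Rightarrow> bool" where
  "log_integrable_weight \<gamma> \<psi> t \<longleftrightarrow> weight \<gamma> \<psi> \<and>
     (\<forall>R\<in>{0<..max_dist \<gamma> t}. set_integrable (length_measure \<gamma>) (portion \<gamma> t R) (log_fun \<psi>))"

definition log_mean :: "(real \<Rightarrow> complex) \<Rightarrow> (complex \<Rightarrow> ennreal) \<Rightarrow> complex \<Rightarrow> real \<Rightarrow> real" where
  "log_mean \<gamma> \<psi> t R =
     set_lebesgue_integral (length_measure \<gamma>) (portion \<gamma> t R) (log_fun \<psi>)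
       / measure (length_measure \<gamma>) (portion \<gamma> t R)"

definition H :: "(real \<Rightarrow> complex) \<Rightarrow> (complex \<Rightarrow> ennreal) \<Rightarrow> complex \<Rightarrow> real \<Rightarrow> real \<Rightarrow> real" where
  "H \<gamma> \<psi> t R1 R2 = exp (log_mean \<gamma> \<psi> t R1) / exp (log_mean \<gamma> \<psi> t R2)"

definition V0 :: "(real \<Rightarrow> complex) \<Rightarrow> (complex \<Rightarrow> ennreal) \<Rightarrow> complex \<Rightarrow> real \<Rightarrow> ennreal" where
  "V0 \<gamma> \<psi> t x = Limsup (at_right 0) (\<lambda>R. ennreal (H \<gamma> \<psi> t (x * R) R))"

end

theory Submission
  imports Defs "HOL-Library.Landau_Symbols"
begin

text \<open>
  The key point is that near a point \<open>t\<close> of the curve the logarithmic mean of \<open>w\<close> over a portion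
  is, up to a bounded error, the value of a function of the radius alone:
  \<open>log_mean \<gamma> w t R = h R + O(1)\<close> as \<open>R \<rightarrow> 0\<close>, where \<open>h = ln w_k\<close> if \<open>t = t_k\<close> and \<open>h = 0\<close> if \<open>t\<close> is
  none of the \<open>t_k\<close>. Dividing logarithms by \<open>ln x\<close> destroys every bounded error, so \<open>V_t^0 w\<close> and the
  function \<open>x \<mapsto> limsup exp (h (x R) - h R)\<close>, which is \<open>\<Phi>^0_{w_k}\<close> or constantly \<open>1\<close>, have the same
  indices.

  The error is bounded for two reasons. First, almost monotonicity of \<open>x^\<alpha> w_k(x)\<close> and
  \<open>x^\<beta> / w_k(x)\<close> says that \<open>ln w_k\<close> is, as a function of \<open>ln x\<close>, Lipschitz up to an
  additive constant (\<open>class_WW_eq_exp\<close>). Second, the mean of \<open>ln (R / |\<tau> - t|)\<close> over the portion of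
  radius \<open>R\<close> is bounded: the integral is at most a multiple of \<open>R\<close> by the Carleson condition, summed
  over dyadic radii (\<open>log_integral_le\<close>), while the measure of the portion is at least \<open>R / 2\<close> since
  the curve has to cross it (\<open>emeasure_portion_ge\<close>). Together they give \<open>portion_mean_at_center\<close>; the
  factors \<open>w_j(|\<tau> - t_j|)\<close> with \<open>t_j \<noteq> t\<close> contribute \<open>O(1)\<close> since they are bounded and bounded away
  from zero near \<open>t\<close>.

  The rest is soft. The coarse Lipschitz property survives bounded perturbations, and it makes
  \<open>V_t^0 w\<close> positive, finite and locally bounded; submultiplicativity is inherited from
  \<open>g (x y R) - g R = (g (x y R) - g (y R)) + (g (y R) - g R)\<close>. Fekete's lemma in logarithmic
  coordinates turns the supremum and the infimum in the definition of the indices into limits, which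
  can then be compared (\<open>dilation_limsup_indices\<close>).

  To know that the length measure behaves as expected, it has to be checked that the arc length is
  right continuous, since only then does it determine its Lebesgue--Stieltjes measure
  (\<open>arclength_right_continuous\<close>).
\<close>

section \<open>Variation and arc length\<close>

definition chain_length :: "(real \<Rightarrow> complex) \<Rightarrow> nat \<Rightarrow> (nat \<Rightarrow> real) \<Rightarrow> ennreal" where
  "chain_length \<gamma> n p = (\<Sum>i<n. ennreal (dist (\<gamma> (p i)) (\<gamma> (p (Suc i)))))"

lemma chain_length_le_variation:
  assumes "mono_on {..n} p" "p ` {..n} \<subseteq> S"
  shows "chain_length \<gamma> n p \<le> variation_on \<gamma> S"
  unfolding variation_on_def chain_length_def
  by (rule SUP_upper2[where i = "(n, p)"]) (use assms in auto)

lemma variation_on_le: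
  assumes "\<And>n p. mono_on {..n} p \<Longrightarrow> p ` {..n} \<subseteq> S \<Longrightarrow> chain_length \<gamma> n p \<le> v"
  shows "variation_on \<gamma> S \<le> v"
  unfolding variation_on_def using assms by (intro SUP_least) (auto simp: chain_length_def)

lemma variation_on_mono: "S \<subseteq> T \<Longrightarrow> variation_on \<gamma> S \<le> variation_on \<gamma> T"
  by (rule variation_on_le, rule chain_length_le_variation) auto

lemma dist_le_variation_on:
  assumes "x \<le> y" "x \<in> S" "y \<in> S"
  shows "ennreal (dist (\<gamma> x) (\<gamma> y)) \<le> variation_on \<gamma> S"
proof -
  have "chain_length \<gamma> 1 (\<lambda>i. if i = 0 then x else y) \<le> variation_on \<gamma> S"
    using assms by (intro chain_length_le_variation) (auto intro!: monotone_onI)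
  then show ?thesis by (simp add: chain_length_def)
qed

lemma variation_on_empty: "variation_on \<gamma> {} = 0"
  using variation_on_le[of "{}" \<gamma> 0] by auto

text \<open>Two chains are joined end to end; the connecting segment only adds length.\<close>

lemma chain_length_add_le_variation:
  assumes "mono_on {..n} p" "p ` {..n} \<subseteq> {a..x}" "mono_on {..m} q" "q ` {..m} \<subseteq> {x..b}"
  shows "chain_length \<gamma> n p + chain_length \<gamma> m q \<le> variation_on \<gamma> {a..b}"
proof -
  let ?r = "\<lambda>i. if i \<le> n then p i else q (i - Suc n)"
  have p: "a \<le> p i" "p i \<le> x" if "i \<le> n" for i
    using assms(2) that by auto
  have q: "x \<le> q i" "q i \<le> b" if "i \<le> m" for i
    using assms(4) that by auto
  have "a \<le> x" "x \<le> b" using p[of 0] q[of 0] by auto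
  have mono: "mono_on {..Suc (n + m)} ?r"
  proof (rule monotone_onI)
    fix i j assume ij: "i \<in> {..Suc (n + m)}" "j \<in> {..Suc (n + m)}" "i \<le> j"
    consider "j \<le> n" | "i \<le> n" "n < j" | "n < i" by linarith
    then show "?r i \<le> ?r j"
    proof cases
      case 1
      then show ?thesis using ij assms(1) by (auto simp: monotone_on_def)
    next
      case 2
      then have "j - Suc n \<le> m" using ij by auto
      then show ?thesis using 2 p(2)[of i] q(1)[of "j - Suc n"] by auto
    next
      case 3
      then show ?thesis using ij assms(3) by (auto simp: monotone_on_def)
    qed
  qed
  have range: "?r ` {..Suc (n + m)} \<subseteq> {a..b}"
  proof
    fix y assume "y \<in> ?r ` {..Suc (n + m)}"
    then obtain i where "i \<in> {..Suc (n + m)}" "y = ?r i" by (elim imageE)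
    then have i: "i \<le> Suc (n + m)" "y = ?r i" by auto
    show "y \<in> {a..b}"
    proof (cases "i \<le> n")
      case True
      then show ?thesis using i p[of i] \<open>x \<le> b\<close> by auto
    next
      case False
      then have "i - Suc n \<le> m" using i by auto
      then show ?thesis using False i q[of "i - Suc n"] \<open>a \<le> x\<close> by auto
    qed
  qed
  have "chain_length \<gamma> n p = (\<Sum>i<n. ennreal (dist (\<gamma> (?r i)) (\<gamma> (?r (Suc i)))))"
    by (auto simp: chain_length_def intro!: sum.cong)
  moreover have "chain_length \<gamma> m q
      = (\<Sum>i\<in>(\<lambda>i. i + Suc n) ` {..<m}. ennreal (dist (\<gamma> (?r i)) (\<gamma> (?r (Suc i)))))"
    by (subst sum.reindex) (auto simp: chain_length_def inj_on_def intro!: sum.cong)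
  ultimately have "chain_length \<gamma> n p + chain_length \<gamma> m q
      = (\<Sum>i\<in>{..<n} \<union> (\<lambda>i. i + Suc n) ` {..<m}. ennreal (dist (\<gamma> (?r i)) (\<gamma> (?r (Suc i)))))"
    by (subst sum.union_disjoint) auto
  also have "\<dots> \<le> chain_length \<gamma> (Suc (n + m)) ?r"
    unfolding chain_length_def by (rule sum_mono2) auto
  also have "\<dots> \<le> variation_on \<gamma> {a..b}"
    by (rule chain_length_le_variation[OF mono range])
  finally show ?thesis .
qed

lemma variation_on_Icc_superadditive:
  assumes "a \<le> x" "x \<le> b"
  shows "variation_on \<gamma> {a..x} + variation_on \<gamma> {x..b} \<le> variation_on \<gamma> {a..b}"
proof -
  let ?C = "\<lambda>S. {(n :: nat, p :: nat \<Rightarrow> real). mono_on {..n} p \<and> p ` {..n} \<subseteq> S}"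
  have ne: "?C {c..d} \<noteq> {}" if "c \<le> d" for c d
  proof -
    have "(0, \<lambda>_. c) \<in> ?C {c..d}" using that by (auto intro!: monotone_onI)
    then show ?thesis by blast
  qed
  have V: "variation_on \<gamma> S = (SUP z\<in>?C S. chain_length \<gamma> (fst z) (snd z))" for S
    unfolding variation_on_def chain_length_def by (simp add: case_prod_unfold)
  show ?thesis
    unfolding V[of "{a..x}"] V[of "{x..b}"]
    apply (subst ennreal_SUP_add_left[symmetric])
     apply (rule ne[OF assms(1)])
    apply (rule SUP_least)
    apply (subst ennreal_SUP_add_right)
     apply (rule ne[OF assms(2)])
    apply (rule SUP_least)
    using chain_length_add_le_variation by fastforce
qed

text \<open>
  Truncating a chain from above and from below at \<open>x\<close> yields one chain on either side, and by the
  triangle inequality the only link that crosses \<open>x\<close> is not longer than its two pieces.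
\<close>

lemma variation_on_Icc_subadditive:
  assumes "a \<le> x" "x \<le> b"
  shows "variation_on \<gamma> {a..b} \<le> variation_on \<gamma> {a..x} + variation_on \<gamma> {x..b}"
proof (rule variation_on_le)
  fix n p assume p: "mono_on {..n} (p :: nat \<Rightarrow> real)" "p ` {..n} \<subseteq> {a..b}"
  define p1 p2 where "p1 i = min (p i) x" and "p2 i = max (p i) x" for i
  have ple: "p i \<le> p (Suc i)" if "i < n" for i
    using p(1) that by (auto simp: monotone_on_def)
  have "ennreal (dist (\<gamma> (p i)) (\<gamma> (p (Suc i))))
      \<le> ennreal (dist (\<gamma> (p1 i)) (\<gamma> (p1 (Suc i)))) + ennreal (dist (\<gamma> (p2 i)) (\<gamma> (p2 (Suc i))))"
    if "i < n" for i
  proof -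
    have "dist (\<gamma> (p i)) (\<gamma> (p (Suc i)))
      \<le> dist (\<gamma> (p1 i)) (\<gamma> (p1 (Suc i))) + dist (\<gamma> (p2 i)) (\<gamma> (p2 (Suc i)))"
      using ple[OF that] dist_triangle[of "\<gamma> (p i)" "\<gamma> (p (Suc i))" "\<gamma> x"]
      unfolding p1_def p2_def min_def max_def by auto
    then show ?thesis
      by (subst ennreal_plus[symmetric]) (auto intro!: ennreal_leI simp del: ennreal_plus)
  qed
  then have "chain_length \<gamma> n p \<le> chain_length \<gamma> n p1 + chain_length \<gamma> n p2"
    unfolding chain_length_def sum.distrib[symmetric] by (intro sum_mono) auto
  also have "\<dots> \<le> variation_on \<gamma> {a..x} + variation_on \<gamma> {x..b}"
  proof (intro add_mono chain_length_le_variation)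
    show "mono_on {..n} p1" "mono_on {..n} p2"
      using p(1) unfolding monotone_on_def p1_def p2_def by (fastforce simp: min_def max_def)+
    show "p1 ` {..n} \<subseteq> {a..x}" "p2 ` {..n} \<subseteq> {x..b}"
      using p(2) assms unfolding p1_def p2_def by (auto simp: subset_iff image_iff)
  qed
  finally show "chain_length \<gamma> n p \<le> variation_on \<gamma> {a..x} + variation_on \<gamma> {x..b}" .
qed

text \<open>
  A chain that almost exhausts the variation on \<open>[x,b]\<close> still does so, by continuity, when it is
  truncated from below at a point \<open>y\<close> slightly to the right of \<open>x\<close>; so little variation is left
  for \<open>[x,y]\<close>.
\<close>

lemma variation_on_Icc_right_small:
  assumes cont: "continuous_on {x..b} \<gamma>" and fin: "variation_on \<gamma> {x..b} < \<infinity>"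
    and "x < b" "0 < e"
  shows "\<exists>y\<in>{x<..b}. variation_on \<gamma> {x..y} \<le> ennreal e"
proof -
  define V where "V = enn2real (variation_on \<gamma> {x..b})"
  have V: "variation_on \<gamma> {x..b} = ennreal V"
    using fin by (auto simp: V_def)
  have "V \<ge> 0" by (simp add: V_def)
  obtain n p where p: "mono_on {..n} p" "p ` {..n} \<subseteq> {x..b}"
    and near: "V < enn2real (chain_length \<gamma> n p) + e / 2"
  proof (rule ccontr)
    assume "\<not> thesis"
    then have *: "\<And>n p. mono_on {..n} p \<Longrightarrow> p ` {..n} \<subseteq> {x..b} \<Longrightarrow>
        V \<ge> enn2real (chain_length \<gamma> n p) + e / 2" using that by force
    have "chain_length \<gamma> n p \<le> ennreal (V - e / 2)"
      if "mono_on {..n} p" "p ` {..n} \<subseteq> {x..b}" for n p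
    proof -
      have "chain_length \<gamma> n p < \<infinity>" by (simp add: chain_length_def)
      then have "chain_length \<gamma> n p = ennreal (enn2real (chain_length \<gamma> n p))" by simp
      also have "\<dots> \<le> ennreal (V - e / 2)" using *[OF that] by (intro ennreal_leI) auto
      finally show ?thesis .
    qed
    then have "ennreal V \<le> ennreal (V - e / 2)" unfolding V[symmetric] by (rule variation_on_le)
    moreover have "V \<ge> e / 2"
      using *[of 0 "\<lambda>_. x"] \<open>x < b\<close> by (auto simp: chain_length_def monotone_on_def)
    ultimately show False using \<open>0 < e\<close> by (simp add: ennreal_le_iff)
  qed
  \<comment> \<open>the length of the chain truncated from below at \<open>y\<close>\<close>
  define D where "D y = (\<Sum>i<n. dist (\<gamma> (max (p i) y)) (\<gamma> (max (p (Suc i)) y)))" for y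
  have p_in: "p i \<in> {x..b}" if "i \<le> n" for i using p(2) that by auto
  have c: "chain_length \<gamma> n (\<lambda>i. max (p i) y) = ennreal (D y)" for y
    by (simp add: chain_length_def D_def)
  have "chain_length \<gamma> n p = chain_length \<gamma> n (\<lambda>i. max (p i) x)"
    unfolding chain_length_def using p_in by (intro sum.cong) (auto simp: max_absorb1)
  then have near': "V < D x + e / 2" using near by (simp add: c D_def sum_nonneg)
  have "continuous_on {x..b} (\<lambda>y. \<gamma> (max (p i) y))" if "i \<le> n" for i
    using p_in[OF that]
    by (intro continuous_on_compose2[OF cont] continuous_intros) auto
  then have "continuous_on {x..b} D"
    unfolding D_def by (intro continuous_intros) auto
  then have "(D \<longlongrightarrow> D x) (at x within {x..b})"
    using \<open>x < b\<close> by (auto simp: continuous_on_def)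
  then have "\<forall>\<^sub>F y in at x within {x..b}. V - e / 2 - e / 2 < D y"
    by (rule order_tendstoD) (use near' \<open>0 < e\<close> in auto)
  then obtain d where d: "d > 0"
    "\<And>y. y \<in> {x..b} \<Longrightarrow> y \<noteq> x \<Longrightarrow> dist y x < d \<Longrightarrow> V - e / 2 - e / 2 < D y"
    unfolding eventually_at by blast
  define y where "y = min b (x + d / 2)"
  have y: "x < y" "y \<le> b" "V - e < D y"
    using d(1) d(2)[of y] \<open>x < b\<close> by (auto simp: y_def dist_real_def min_def split: if_splits)
  have "ennreal (D y) \<le> variation_on \<gamma> {y..b}"
    unfolding c[symmetric] using p p_in y
    by (intro chain_length_le_variation) (fastforce simp: monotone_on_def max_def)+
  then have "variation_on \<gamma> {x..y} + ennreal (D y) \<le> variation_on \<gamma> {x..y} + variation_on \<gamma> {y..b}"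
    by (rule add_left_mono)
  also have "\<dots> \<le> ennreal V"
    using variation_on_Icc_superadditive[of x y b \<gamma>] y by (simp add: V)
  finally have le: "variation_on \<gamma> {x..y} + ennreal (D y) \<le> ennreal V" .
  then have "variation_on \<gamma> {x..y} < \<infinity>"
    by (metis ennreal_add_eq_top ennreal_less_top infinity_ennreal_def leD less_top top.not_eq_extremum)
  then obtain v where v: "variation_on \<gamma> {x..y} = ennreal v" "v \<ge> 0"
    by (metis ennreal_cases infinity_ennreal_def less_irrefl)
  have "D y \<ge> 0" by (simp add: D_def sum_nonneg)
  then have "v + D y \<le> V"
    using le v \<open>V \<ge> 0\<close> by (simp flip: ennreal_plus)
  then have "variation_on \<gamma> {x..y} \<le> ennreal e"
    unfolding v using y by (intro ennreal_leI) auto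
  then show ?thesis using y by auto
qed

lemma rectifiable_variation_finite:
  assumes "rectifiable \<gamma>" "S \<subseteq> {0..1}"
  shows "variation_on \<gamma> S < \<infinity>"
  using assms variation_on_mono[OF assms(2), of \<gamma>] unfolding rectifiable_def
  by (meson order.strict_trans1)

lemma arclength_mono:
  assumes "rectifiable \<gamma>" "x \<le> y"
  shows "arclength \<gamma> x \<le> arclength \<gamma> y"
  unfolding arclength_def using rectifiable_variation_finite[OF assms(1)] assms(2)
  by (intro enn2real_mono variation_on_mono) auto

lemma arclength_Icc: "x \<le> 1 \<Longrightarrow> arclength \<gamma> x = enn2real (variation_on \<gamma> {0..x})"
  unfolding arclength_def by (rule arg_cong[where f = "\<lambda>S. enn2real (variation_on \<gamma> S)"]) auto

lemma arclength_add:
  assumes "rectifiable \<gamma>" "0 \<le> x" "x \<le> y" "y \<le> 1"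
  shows "arclength \<gamma> y = arclength \<gamma> x + enn2real (variation_on \<gamma> {x..y})"
proof -
  have "variation_on \<gamma> {0..y} = variation_on \<gamma> {0..x} + variation_on \<gamma> {x..y}"
    using assms
    by (intro antisym variation_on_Icc_subadditive variation_on_Icc_superadditive) auto
  moreover have "variation_on \<gamma> {0..x} < \<infinity>" "variation_on \<gamma> {x..y} < \<infinity>"
    using assms by (auto simp del: infinity_ennreal_def intro!: rectifiable_variation_finite)
  ultimately show ?thesis using assms by (simp add: arclength_Icc enn2real_plus)
qed

lemma dist_le_arclength_diff:
  assumes "rectifiable \<gamma>" "0 \<le> x" "x \<le> y" "y \<le> 1"
  shows "dist (\<gamma> x) (\<gamma> y) \<le> arclength \<gamma> y - arclength \<gamma> x"
proof -
  have "variation_on \<gamma> {x..y} < \<infinity>"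
    using assms by (auto simp del: infinity_ennreal_def intro!: rectifiable_variation_finite)
  then have "enn2real (ennreal (dist (\<gamma> x) (\<gamma> y))) \<le> enn2real (variation_on \<gamma> {x..y})"
    using assms by (intro enn2real_mono dist_le_variation_on) auto
  then show ?thesis using arclength_add[OF assms] by simp
qed

lemma arclength_right_continuous:
  assumes "path \<gamma>" "rectifiable \<gamma>"
  shows "continuous (at_right x) (arclength \<gamma>)"
proof -
  have small: "\<exists>y>x. arclength \<gamma> y < arclength \<gamma> x + e" if "e > 0" for e
  proof -
    consider "x < 0" | "1 \<le> x" | "0 \<le> x" "x < 1" by linarith
    then show ?thesis
    proof cases
      case 1
      then have "arclength \<gamma> (x / 2) = arclength \<gamma> x"
        by (simp add: arclength_Icc variation_on_empty)
      then show ?thesis using 1 that by (intro exI[of _ "x / 2"]) auto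
    next
      case 2
      have const: "arclength \<gamma> z = arclength \<gamma> 1" if "z \<ge> 1" for z
        unfolding arclength_def using that
        by (intro arg_cong[where f = "\<lambda>S. enn2real (variation_on \<gamma> S)"]) auto
      show ?thesis using const[of x] const[of "x + 1"] 2 that by (intro exI[of _ "x + 1"]) auto
    next
      case 3
      have "continuous_on {x..1} \<gamma>"
        using assms(1) 3 unfolding path_def by (elim continuous_on_subset) auto
      moreover have "variation_on \<gamma> {x..1} < \<infinity>"
        using 3 assms(2)
        by (auto simp del: infinity_ennreal_def intro!: rectifiable_variation_finite)
      ultimately obtain y where y: "y \<in> {x<..1}" "variation_on \<gamma> {x..y} \<le> ennreal (e / 2)"
        using variation_on_Icc_right_small[of x 1 \<gamma> "e / 2"] 3 \<open>e > 0\<close> by auto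
      then have "enn2real (variation_on \<gamma> {x..y}) \<le> e / 2"
        using \<open>e > 0\<close> by (intro enn2real_leI) auto
      then show ?thesis
        using arclength_add[OF assms(2), of x y] 3 y \<open>e > 0\<close> by (intro exI[of _ y]) auto
    qed
  qed
  have "(arclength \<gamma> \<longlongrightarrow> arclength \<gamma> x) (at_right x)"
  proof (rule order_tendstoI)
    fix a assume "a < arclength \<gamma> x"
    then have "a < arclength \<gamma> y" if "x < y" for y
      using arclength_mono[OF assms(2), of x y] that by simp
    then show "\<forall>\<^sub>F y in at_right x. a < arclength \<gamma> y"
      by (rule eventually_mono[OF eventually_at_right_less])
  next
    fix a assume "arclength \<gamma> x < a"
    then obtain y where "y > x" "arclength \<gamma> y < a"
      using small[of "a - arclength \<gamma> x"] by auto
    then show "\<forall>\<^sub>F y in at_right x. arclength \<gamma> y < a"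
      using arclength_mono[OF assms(2)]
      unfolding eventually_at_right_field by (meson less_imp_le order.strict_trans1)
  qed
  then show ?thesis by (simp add: continuous_within)
qed

section \<open>The length measure of a rectifiable Carleson curve\<close>

lemma space_length_measure [simp]: "space (length_measure \<gamma>) = path_image \<gamma>"
  by (simp add: length_measure_def space_restrict_space)

lemma borel_in_sets_length_measure:
  "A \<in> sets borel \<Longrightarrow> path_image \<gamma> \<inter> A \<in> sets (length_measure \<gamma>)"
  unfolding length_measure_def by (intro sets_completionI_sets) (auto simp: sets_restrict_space)

lemma borel_measurable_length_measureI:
  "f \<in> borel_measurable borel \<Longrightarrow> f \<in> borel_measurable (length_measure \<gamma>)"
  unfolding length_measure_def
  by (intro measurable_completion) (simp add: measurable_restrict_space1)

lemma portion_eq: "portion \<gamma> t R = path_image \<gamma> \<inter> ball t R"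
  by (auto simp: portion_def dist_norm norm_minus_commute)

lemma portion_in_sets [simp, measurable]: "portion \<gamma> t R \<in> sets (length_measure \<gamma>)"
  unfolding portion_eq by (intro borel_in_sets_length_measure) auto

lemma emeasure_length_measure:
  assumes "path \<gamma>" "A \<in> sets borel"
  shows "emeasure (length_measure \<gamma>) (path_image \<gamma> \<inter> A)
    = emeasure (interval_measure (arclength \<gamma>)) (\<gamma> -` A \<inter> {0..1})"
proof -
  let ?I = "restrict_space (interval_measure (arclength \<gamma>)) {0..1}"
  let ?G = "restrict_space borel (path_image \<gamma>)"
  have "\<gamma> \<in> borel_measurable (restrict_space borel {0..1})"
    using assms(1) unfolding path_def by (rule borel_measurable_continuous_on_restrict)
  moreover have "sets (restrict_space borel {0..1}) = sets ?I"
    by (intro sets_restrict_space_cong) simp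
  ultimately have "\<gamma> \<in> borel_measurable ?I"
    using measurable_cong_sets by blast
  then have meas: "\<gamma> \<in> measurable ?I ?G"
    by (intro measurable_restrict_space2) (auto simp: space_restrict_space path_image_def)
  have A: "path_image \<gamma> \<inter> A \<in> sets ?G"
    using assms(2) by (auto simp: sets_restrict_space)
  have "emeasure (length_measure \<gamma>) (path_image \<gamma> \<inter> A) = emeasure (distr ?I ?G \<gamma>) (path_image \<gamma> \<inter> A)"
    unfolding length_measure_def using A by simp
  also have "\<dots> = emeasure ?I (\<gamma> -` (path_image \<gamma> \<inter> A) \<inter> space ?I)"
    by (rule emeasure_distr[OF meas A])
  also have "\<gamma> -` (path_image \<gamma> \<inter> A) \<inter> space ?I = \<gamma> -` A \<inter> {0..1}"
    by (auto simp: space_restrict_space path_image_def)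
  also have "emeasure ?I (\<gamma> -` A \<inter> {0..1}) = emeasure (interval_measure (arclength \<gamma>)) (\<gamma> -` A \<inter> {0..1})"
    by (rule emeasure_restrict_space) auto
  finally show ?thesis .
qed

text \<open>
  The length measure of a set is at least the length, hence at least the diameter, of any arc that
  it contains.
\<close>

lemma dist_le_emeasure_length_measure:
  assumes "path \<gamma>" "rectifiable \<gamma>" "A \<in> sets borel"
    and "0 \<le> a" "a \<le> b" "b \<le> 1" "\<gamma> ` {a<..b} \<subseteq> A"
  shows "ennreal (dist (\<gamma> a) (\<gamma> b)) \<le> emeasure (length_measure \<gamma>) (path_image \<gamma> \<inter> A)"
proof -
  have "ennreal (dist (\<gamma> a) (\<gamma> b)) \<le> ennreal (arclength \<gamma> b - arclength \<gamma> a)"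
    using dist_le_arclength_diff[of \<gamma> a b] assms by (intro ennreal_leI) auto
  also have "\<dots> = emeasure (interval_measure (arclength \<gamma>)) {a<..b}"
    using assms by (subst emeasure_interval_measure_Ioc)
      (auto intro: arclength_mono arclength_right_continuous)
  also have "\<dots> \<le> emeasure (interval_measure (arclength \<gamma>)) (\<gamma> -` A \<inter> {0..1})"
  proof (rule emeasure_mono)
    show "{a<..b} \<subseteq> \<gamma> -` A \<inter> {0..1}" using assms by auto
    have "\<gamma> \<in> borel_measurable (restrict_space borel {0..1})"
      using assms(1) unfolding path_def by (rule borel_measurable_continuous_on_restrict)
    from measurable_sets[OF this assms(3)]
    show "\<gamma> -` A \<inter> {0..1} \<in> sets (interval_measure (arclength \<gamma>))"
      by (simp add: space_restrict_space sets_restrict_space_iff)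
  qed
  also have "\<dots> = emeasure (length_measure \<gamma>) (path_image \<gamma> \<inter> A)"
    using assms by (simp add: emeasure_length_measure)
  finally show ?thesis .
qed

text \<open>
  Starting from \<open>t\<close> the curve has to cross the distance from \<open>0\<close> to \<open>R/2\<close> before it can leave the
  portion.
\<close>

lemma emeasure_portion_ge:
  assumes "path \<gamma>" "rectifiable \<gamma>" "t \<in> path_image \<gamma>" "\<tau> \<in> path_image \<gamma>"
    and "0 < R" "R \<le> dist \<tau> t"
  shows "ennreal (R / 2) \<le> emeasure (length_measure \<gamma>) (portion \<gamma> t R)"
proof -
  obtain a s where a: "a \<in> {0..1}" "t = \<gamma> a" and s: "s \<in> {0..1}" "\<tau> = \<gamma> s"
    using assms(3,4) by (auto simp: path_image_def)
  have cont: "continuous_on {0..1} (\<lambda>u. dist (\<gamma> u) t)"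
    using assms(1) unfolding path_def by (intro continuous_intros)
  have arc: "ennreal (R / 2) \<le> emeasure (length_measure \<gamma>) (portion \<gamma> t R)"
    if "0 \<le> u" "u \<le> v" "v \<le> 1" "R / 2 \<le> dist (\<gamma> u) (\<gamma> v)" "\<gamma> ` {u<..v} \<subseteq> ball t R" for u v
  proof -
    have "ennreal (R / 2) \<le> ennreal (dist (\<gamma> u) (\<gamma> v))"
      using that by (intro ennreal_leI)
    also have "\<dots> \<le> emeasure (length_measure \<gamma>) (portion \<gamma> t R)"
      unfolding portion_eq using that by (intro dist_le_emeasure_length_measure assms) auto
    finally show ?thesis .
  qed
  show ?thesis
  proof (cases "a \<le> s")
    case True
    have cont': "continuous_on {a..s} (\<lambda>u. dist (\<gamma> u) t)"
      using a s by (intro continuous_on_subset[OF cont]) auto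
    \<comment> \<open>the arc from \<open>t\<close> to the first point at distance \<open>R / 2\<close> stays within the portion\<close>
    define Z where "Z = {u \<in> {a..s}. dist (\<gamma> u) t \<in> {R / 2}}"
    have "\<exists>u\<ge>a. u \<le> s \<and> dist (\<gamma> u) t = R / 2"
      using assms(5,6) a s True by (intro IVT' cont') auto
    then have "Z \<noteq> {}" by (auto simp: Z_def)
    moreover have "compact Z"
      unfolding Z_def using continuous_closed_preimage[OF cont', of "{R / 2}"]
      by (auto simp: compact_eq_bounded_closed vimage_def Int_def intro: bounded_subset[of "{a..s}"])
    ultimately obtain b where b: "b \<in> Z" "\<And>u. u \<in> Z \<Longrightarrow> b \<le> u"
      using compact_attains_inf[of Z] by blast
    have "dist (\<gamma> u) t < R" if u: "u \<in> {a<..b}" for u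
    proof (rule ccontr)
      assume far: "\<not> dist (\<gamma> u) t < R"
      then have "\<exists>v\<ge>a. v \<le> u \<and> dist (\<gamma> v) t = R / 2"
        using assms(5) a b(1) u
        by (intro IVT' continuous_on_subset[OF cont']) (auto simp: Z_def)
      then obtain v where "v \<in> Z" "v \<le> u" using u b(1) by (auto simp: Z_def)
      then have "u = b" using b(2)[of v] u by auto
      then show False using far b(1) \<open>R > 0\<close> by (auto simp: Z_def)
    qed
    then show ?thesis
      using a s b(1) by (intro arc[of a b]) (auto simp: Z_def dist_commute)
  next
    case False
    have cont': "continuous_on {s..a} (\<lambda>u. dist (\<gamma> u) t)"
      using a s by (intro continuous_on_subset[OF cont]) auto
    \<comment> \<open>going backwards, the arc may start at the last point at distance at least \<open>R / 2\<close>: its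
      initial point does not count\<close>
    define Z where "Z = {u \<in> {s..a}. dist (\<gamma> u) t \<in> {R / 2..}}"
    have "s \<in> Z" using assms(5,6) s False by (auto simp: Z_def)
    then have "Z \<noteq> {}" by auto
    moreover have "compact Z"
      unfolding Z_def using continuous_closed_preimage[OF cont', of "{R / 2..}"]
      by (auto simp: compact_eq_bounded_closed vimage_def Int_def intro: bounded_subset[of "{s..a}"])
    ultimately obtain b where b: "b \<in> Z" "\<And>u. u \<in> Z \<Longrightarrow> u \<le> b"
      using compact_attains_sup[of Z] by blast
    have "dist (\<gamma> u) t < R" if u: "u \<in> {b<..a}" for u
      using b(1) b(2)[of u] u \<open>R > 0\<close> by (force simp: Z_def)
    then show ?thesis
      using a s b(1) by (intro arc[of b a]) (auto simp: Z_def dist_commute)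
  qed
qed

lemma Carleson_bound:
  assumes "Carleson \<gamma>"
  shows "\<exists>C\<ge>0. \<forall>t\<in>path_image \<gamma>. \<forall>R>0.
    emeasure (length_measure \<gamma>) (portion \<gamma> t R) \<le> ennreal (C * R)"
proof -
  define S where "S = (SUP t \<in> path_image \<gamma>. SUP R \<in> {0<..}.
        emeasure (length_measure \<gamma>) (portion \<gamma> t R) / ennreal R)"
  define C where "C = enn2real S"
  have "C \<ge> 0" by (simp add: C_def)
  have S: "S = ennreal C"
    using assms unfolding Carleson_def S_def[symmetric] by (simp add: C_def)
  have "emeasure (length_measure \<gamma>) (portion \<gamma> t R) \<le> ennreal (C * R)"
    if "t \<in> path_image \<gamma>" "0 < R" for t R
  proof -
    have "emeasure (length_measure \<gamma>) (portion \<gamma> t R) / ennreal R \<le> S"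
      unfolding S_def using that by (intro SUP_upper2[of t] SUP_upper2[of R]) auto
    then have "emeasure (length_measure \<gamma>) (portion \<gamma> t R) / ennreal R * ennreal R \<le> S * ennreal R"
      by (rule mult_right_mono) simp
    moreover have "emeasure (length_measure \<gamma>) (portion \<gamma> t R) / ennreal R * ennreal R
        = emeasure (length_measure \<gamma>) (portion \<gamma> t R)"
      using that by (simp add: ennreal_divide_times ennreal_divide_self)
    ultimately show ?thesis using that \<open>C \<ge> 0\<close> by (simp add: S ennreal_mult)
  qed
  then show ?thesis using \<open>C \<ge> 0\<close> by blast
qed

lemma Carleson_finite_measure:
  assumes "path \<gamma>" "Carleson \<gamma>"
  shows "finite_measure (length_measure \<gamma>)"
proof
  obtain C where C: "0 \<le> C" "\<And>t R. t \<in> path_image \<gamma> \<Longrightarrow> 0 < R \<Longrightarrow>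
        emeasure (length_measure \<gamma>) (portion \<gamma> t R) \<le> ennreal (C * R)"
    using Carleson_bound[OF assms(2)] by blast
  obtain t where t: "t \<in> path_image \<gamma>" by (meson all_not_in_conv path_image_nonempty)
  obtain r where r: "r > 0" "path_image \<gamma> \<subseteq> ball t r"
    using bounded_subset_ballD[OF bounded_path_image[OF assms(1)]] by blast
  have "space (length_measure \<gamma>) = portion \<gamma> t r" using r by (auto simp: portion_eq)
  then have "emeasure (length_measure \<gamma>) (space (length_measure \<gamma>)) \<le> ennreal (C * r)"
    using C(2)[OF t r(1)] by simp
  then show "emeasure (length_measure \<gamma>) (space (length_measure \<gamma>)) \<noteq> \<infinity>"
    by (auto simp: top_unique)
qed

text \<open>A point lies in portions of arbitrarily small radius, and a small radius forces a small measure.\<close>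

lemma Carleson_points_null:
  assumes "Carleson \<gamma>" "t \<in> path_image \<gamma>"
  shows "{t} \<in> null_sets (length_measure \<gamma>)"
proof -
  obtain C where C: "0 \<le> C" "\<And>t R. t \<in> path_image \<gamma> \<Longrightarrow> 0 < R \<Longrightarrow>
        emeasure (length_measure \<gamma>) (portion \<gamma> t R) \<le> ennreal (C * R)"
    using Carleson_bound[OF assms(1)] by blast
  have "path_image \<gamma> \<inter> {t} \<in> sets (length_measure \<gamma>)"
    by (rule borel_in_sets_length_measure) auto
  then have sets: "{t} \<in> sets (length_measure \<gamma>)" using assms(2) by (simp add: Int_insert_right)
  have "emeasure (length_measure \<gamma>) {t} \<le> ennreal e" if "e > 0" for e
  proof -
    have "emeasure (length_measure \<gamma>) {t} \<le> emeasure (length_measure \<gamma>) (portion \<gamma> t (e / (C + 1)))"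
      using assms(2) that C(1) by (intro emeasure_mono portion_in_sets) (auto simp: portion_eq)
    also have "\<dots> \<le> ennreal (C * (e / (C + 1)))"
      by (rule C(2)[OF assms(2)]) (use that C(1) in simp)
    also have "\<dots> \<le> ennreal e"
      using that C(1) by (intro ennreal_leI) (auto simp: field_simps)
    finally show ?thesis .
  qed
  then have "emeasure (length_measure \<gamma>) {t} \<le> 0"
    by - (rule ennreal_le_epsilon, simp)
  then show ?thesis using sets by auto
qed

lemma dist_le_curve_length:
  assumes "path \<gamma>" "rectifiable \<gamma>" "Carleson \<gamma>" "x \<in> path_image \<gamma>" "y \<in> path_image \<gamma>"
  shows "dist x y \<le> curve_length \<gamma>"
proof -
  interpret finite_measure "length_measure \<gamma>"
    by (rule Carleson_finite_measure) fact+
  obtain a b where ab: "a \<in> {0..1}" "x = \<gamma> a" "b \<in> {0..1}" "y = \<gamma> b"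
    using assms by (auto simp: path_image_def)
  have "ennreal (dist x y) \<le> emeasure (length_measure \<gamma>) (path_image \<gamma> \<inter> UNIV)"
  proof (cases "a \<le> b")
    case True
    then show ?thesis using ab assms(1,2)
      dist_le_emeasure_length_measure[of \<gamma> UNIV a b] by auto
  next
    case False
    then show ?thesis using ab assms(1,2)
      dist_le_emeasure_length_measure[of \<gamma> UNIV b a] by (auto simp: dist_commute)
  qed
  then show ?thesis
    by (simp add: curve_length_def emeasure_eq_measure)
qed

section \<open>Logarithmic integrals on Carleson curves\<close>

locale Carleson_Jordan_curve =
  fixes \<gamma> :: "real \<Rightarrow> complex"
  assumes Jordan: "Jordan_curve \<gamma>" and rectifiable: "rectifiable \<gamma>" and Carleson: "Carleson \<gamma>"
begin

lemma path: "path \<gamma>"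
  using Jordan by (simp add: Jordan_curve_def simple_path_imp_path)

sublocale finite_measure "length_measure \<gamma>"
  by (rule Carleson_finite_measure[OF path Carleson])

lemma measure_portion_ge:
  assumes "t \<in> path_image \<gamma>"
  obtains r where "0 < r" "\<And>R. 0 < R \<Longrightarrow> R \<le> r \<Longrightarrow> R / 2 \<le> measure (length_measure \<gamma>) (portion \<gamma> t R)"
proof -
  have "\<exists>\<tau>\<in>path_image \<gamma>. \<tau> \<noteq> t"
  proof (rule ccontr)
    assume "\<not> (\<exists>\<tau>\<in>path_image \<gamma>. \<tau> \<noteq> t)"
    then have "\<gamma> (1/2) = \<gamma> (1/3)"
      using assms by (auto simp: path_image_def)
    moreover have "\<forall>x\<in>{0..1}. \<forall>y\<in>{0..1}. \<gamma> x = \<gamma> y \<longrightarrow> x = y \<or> x = 0 \<and> y = 1 \<or> x = 1 \<and> y = 0"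
      using Jordan by (simp add: Jordan_curve_def simple_path_def loop_free_def)
    from bspec[OF bspec[OF this, of "1/2"], of "1/3"]
    have "\<gamma> (1/2) \<noteq> \<gamma> (1/3)" by auto
    ultimately show False by simp
  qed
  then obtain \<tau> where \<tau>: "\<tau> \<in> path_image \<gamma>" "\<tau> \<noteq> t" by auto
  have "R / 2 \<le> measure (length_measure \<gamma>) (portion \<gamma> t R)" if "0 < R" "R \<le> dist \<tau> t" for R
    using emeasure_portion_ge[OF path rectifiable assms \<tau>(1) that] that
    by (simp add: emeasure_eq_measure)
  then show ?thesis using \<tau> that[of "dist \<tau> t"] by simp
qed

lemma curve_length_pos: "0 < curve_length \<gamma>"
proof -
  obtain t where "t \<in> path_image \<gamma>" using path_image_nonempty by blast
  then obtain r where "0 < r" "r / 2 \<le> measure (length_measure \<gamma>) (portion \<gamma> t r)"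
    using measure_portion_ge[of t] by (metis order.refl)
  then have "0 < measure (length_measure \<gamma>) (portion \<gamma> t r)" by simp
  also have "measure (length_measure \<gamma>) (portion \<gamma> t r) \<le> curve_length \<gamma>"
    unfolding curve_length_def using borel_in_sets_length_measure[of UNIV \<gamma>]
    by (intro finite_measure_mono) (auto simp: portion_eq)
  finally show ?thesis .
qed

lemma set_integrable_const: "set_integrable (length_measure \<gamma>) (portion \<gamma> t R) (\<lambda>_. c :: real)"
  unfolding set_integrable_def by (intro integrable_mult_indicator portion_in_sets integrable_const)

lemma set_integral_portion_const:
  "set_lebesgue_integral (length_measure \<gamma>) (portion \<gamma> t R) (\<lambda>_. c :: real)
    = measure (length_measure \<gamma>) (portion \<gamma> t R) * c"
proof -
  have "portion \<gamma> t R \<inter> path_image \<gamma> = portion \<gamma> t R" by (auto simp: portion_def)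
  then show ?thesis by (simp add: set_lebesgue_integral_def)
qed

lemma AE_neq_point:
  assumes "t \<in> path_image \<gamma>"
  shows "AE \<tau> in length_measure \<gamma>. \<tau> \<noteq> t"
  using AE_not_in[OF Carleson_points_null[OF Carleson assms]] by simp

lemma cmod_diff_le_length:
  "\<tau> \<in> path_image \<gamma> \<Longrightarrow> t \<in> path_image \<gamma> \<Longrightarrow> cmod (\<tau> - t) \<le> curve_length \<gamma>"
  using dist_le_curve_length[OF path rectifiable Carleson] by (simp add: dist_norm)

text \<open>
  Layer cake with dyadic layers: at a point \<open>\<tau>\<close> of the portion, \<open>ln (R / |\<tau> - t|)\<close> is at most
  \<open>ln 2\<close> times the number of concentric portions of radius \<open>R / 2^j\<close> that contain \<open>\<tau>\<close>, and by
  the Carleson condition the measures of these portions add up to a multiple of \<open>R\<close>.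
\<close>

lemma log_integral_le:
  obtains C where "0 \<le> C"
    "\<And>t R. t \<in> path_image \<gamma> \<Longrightarrow> 0 < R \<Longrightarrow>
      set_integrable (length_measure \<gamma>) (portion \<gamma> t R) (\<lambda>\<tau>. ln (R / cmod (\<tau> - t)))"
    "\<And>t R. t \<in> path_image \<gamma> \<Longrightarrow> 0 < R \<Longrightarrow>
      set_lebesgue_integral (length_measure \<gamma>) (portion \<gamma> t R) (\<lambda>\<tau>. ln (R / cmod (\<tau> - t))) \<le> C * R"
proof -
  obtain C where C: "0 \<le> C" "\<And>t R. t \<in> path_image \<gamma> \<Longrightarrow> 0 < R \<Longrightarrow>
        emeasure (length_measure \<gamma>) (portion \<gamma> t R) \<le> ennreal (C * R)"
    using Carleson_bound[OF Carleson] by blast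
  define D where "D = 2 * ln 2 * C"
  have "D \<ge> 0" using C by (simp add: D_def)
  have main: "set_integrable (length_measure \<gamma>) (portion \<gamma> t R) (\<lambda>\<tau>. ln (R / cmod (\<tau> - t))) \<and>
      set_lebesgue_integral (length_measure \<gamma>) (portion \<gamma> t R) (\<lambda>\<tau>. ln (R / cmod (\<tau> - t))) \<le> D * R"
    if t: "t \<in> path_image \<gamma>" and R: "0 < R" for t R
  proof -
    let ?M = "length_measure \<gamma>"
    let ?f = "\<lambda>\<tau>. indicator (portion \<gamma> t R) \<tau> * ln (R / cmod (\<tau> - t))"
    let ?layer = "\<lambda>j \<tau>. ennreal (ln 2) * indicator (portion \<gamma> t (R / 2 ^ j)) \<tau>"
    have layers: "ennreal (?f \<tau>) \<le> (\<Sum>j. ?layer j \<tau>)" for \<tau>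
    proof (cases "\<tau> \<in> portion \<gamma> t R \<and> \<tau> \<noteq> t")
      case True
      define d where "d = cmod (\<tau> - t)"
      have d: "0 < d" "d < R" and \<tau>: "\<tau> \<in> path_image \<gamma>"
        using True by (auto simp: d_def portion_def)
      \<comment> \<open>\<open>\<tau>\<close> lies in the first \<open>N\<close> layers\<close>
      have "\<exists>N. R / d \<le> 2 ^ N"
        using real_arch_pow[of 2 "R / d"] by (auto intro: less_imp_le)
      moreover define N where "N = (LEAST N. R / d \<le> 2 ^ N)"
      ultimately have N: "R / d \<le> 2 ^ N" "\<And>j. j < N \<Longrightarrow> 2 ^ j < R / d"
        by (auto intro: LeastI_ex simp: not_le dest!: not_less_Least)
      have "ln (R / d) \<le> ln (2 ^ N)"
        using N(1) d by (subst ln_le_cancel_iff) auto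
      then have "ln (R / d) \<le> real N * ln 2" by (simp add: ln_realpow)
      then have "ennreal (?f \<tau>) \<le> ennreal (real N * ln 2)"
        using True by (intro ennreal_leI) (simp add: d_def)
      also have "\<dots> = (\<Sum>j<N. ennreal (ln 2))"
        by (simp add: ennreal_mult ennreal_of_nat_eq_real_of_nat)
      also have "\<dots> = (\<Sum>j<N. ?layer j \<tau>)"
      proof (intro sum.cong refl)
        fix j assume "j \<in> {..<N}"
        then have "d < R / 2 ^ j" using N(2)[of j] d by (simp add: field_simps)
        then have "\<tau> \<in> portion \<gamma> t (R / 2 ^ j)" using \<tau> by (simp add: portion_def d_def)
        then show "ennreal (ln 2) = ?layer j \<tau>" by simp
      qed
      also have "\<dots> \<le> (\<Sum>j. ?layer j \<tau>)" by (rule sum_le_suminf) auto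
      finally show ?thesis .
    qed auto
    have meas [measurable]: "?f \<in> borel_measurable ?M"
      by (intro borel_measurable_times borel_measurable_indicator portion_in_sets
          borel_measurable_length_measureI) measurable
    have nonneg: "0 \<le> ?f \<tau>" for \<tau>
    proof (cases "\<tau> \<in> portion \<gamma> t R \<and> \<tau> \<noteq> t")
      case True
      then have "1 \<le> R / cmod (\<tau> - t)" by (auto simp: portion_def)
      then show ?thesis by simp
    qed auto
    have "(\<integral>\<^sup>+ \<tau>. ennreal (?f \<tau>) \<partial>?M) \<le> (\<integral>\<^sup>+ \<tau>. (\<Sum>j. ?layer j \<tau>) \<partial>?M)"
      by (rule nn_integral_mono) (rule layers)
    also have "\<dots> = (\<Sum>j. \<integral>\<^sup>+ \<tau>. ?layer j \<tau> \<partial>?M)"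
      by (rule nn_integral_suminf) auto
    also have "\<dots> = (\<Sum>j. ennreal (ln 2) * emeasure ?M (portion \<gamma> t (R / 2 ^ j)))"
      by (subst nn_integral_cmult_indicator) auto
    also have "\<dots> \<le> (\<Sum>j. ennreal (ln 2 * (C * R) * (1 / 2) ^ j))"
    proof (rule suminf_le)
      fix j
      have "ennreal (ln 2) * emeasure ?M (portion \<gamma> t (R / 2 ^ j)) \<le> ennreal (ln 2) * ennreal (C * (R / 2 ^ j))"
        using C(2)[OF t, of "R / 2 ^ j"] R by (intro mult_left_mono) auto
      also have "\<dots> = ennreal (ln 2 * (C * R) * (1 / 2) ^ j)"
        using C(1) R by (simp add: ennreal_mult[symmetric] power_divide)
      finally show "ennreal (ln 2) * emeasure ?M (portion \<gamma> t (R / 2 ^ j))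
          \<le> ennreal (ln 2 * (C * R) * (1 / 2) ^ j)" .
    qed auto
    also have "\<dots> = ennreal (ln 2 * (C * R) * 2)"
    proof (rule suminf_ennreal_eq)
      show "(\<lambda>j. ln 2 * (C * R) * (1 / 2) ^ j) sums (ln 2 * (C * R) * 2)"
        using geometric_sums[of "1 / 2 :: real"] by (intro sums_mult) simp
    qed (use C R in auto)
    also have "ln 2 * (C * R) * 2 = D * R" by (simp add: D_def)
    finally have le: "(\<integral>\<^sup>+ \<tau>. ennreal (?f \<tau>) \<partial>?M) \<le> ennreal (D * R)" .
    have int: "integrable ?M ?f"
      using le nonneg by (intro integrableI_nonneg) (auto simp: le_less_trans)
    have "(\<integral>\<tau>. ?f \<tau> \<partial>?M) \<le> D * R"
      using le nonneg \<open>D \<ge> 0\<close> R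
      by (intro integral_real_bounded) auto
    then show ?thesis using int by (simp add: set_integrable_def set_lebesgue_integral_def)
  qed
  then show ?thesis using that[of D] \<open>D \<ge> 0\<close> by blast
qed

lemma integrable_ln_dist:
  assumes "t \<in> path_image \<gamma>"
  shows "integrable (length_measure \<gamma>) (\<lambda>\<tau>. ln (cmod (\<tau> - t)))"
proof -
  let ?R = "curve_length \<gamma> + 1"
  have R: "?R > 0" using cmod_diff_le_length[OF assms assms] by simp
  have "portion \<gamma> t ?R = path_image \<gamma>"
    using cmod_diff_le_length[OF _ assms] by (force simp: portion_def)
  moreover have "set_integrable (length_measure \<gamma>) (portion \<gamma> t ?R) (\<lambda>\<tau>. ln (?R / cmod (\<tau> - t)))"
    using log_integral_le assms R by metis
  ultimately have "set_integrable (length_measure \<gamma>) (space (length_measure \<gamma>)) (\<lambda>\<tau>. ln (?R / cmod (\<tau> - t)))"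
    by simp
  then have "integrable (length_measure \<gamma>) (\<lambda>\<tau>. ln (?R / cmod (\<tau> - t)))"
    unfolding set_integrable_def
    by (rule Bochner_Integration.integrable_cong[THEN iffD1, rotated -1]) auto
  then have "integrable (length_measure \<gamma>) (\<lambda>\<tau>. ln ?R - ln (?R / cmod (\<tau> - t)))"
    by (intro Bochner_Integration.integrable_diff) auto
  then show ?thesis
  proof (rule integrable_cong_AE_imp)
    show "AE \<tau> in length_measure \<gamma>. ln ?R - ln (?R / cmod (\<tau> - t)) = ln (cmod (\<tau> - t))"
      using AE_neq_point[OF assms] by eventually_elim (use R in \<open>simp add: ln_div\<close>)
  qed (rule borel_measurable_length_measureI, measurable)
qed

end

section \<open>Functions that are coarsely Lipschitz in logarithmic scale\<close>

text \<open>
  In the coordinate \<open>ln x\<close> this is the notion of a coarsely (large-scale) Lipschitz map. The additive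
  constant \<open>A\<close> makes the property stable under bounded perturbations.
\<close>

definition coarsely_log_Lipschitz :: "real set \<Rightarrow> (real \<Rightarrow> real) \<Rightarrow> bool" where
  "coarsely_log_Lipschitz S g \<longleftrightarrow>
     (\<exists>A\<ge>0. \<exists>B\<ge>0. \<forall>x\<in>S. \<forall>y\<in>S. \<bar>g x - g y\<bar> \<le> A + B * \<bar>ln x - ln y\<bar>)"

text \<open>
  Up to constants, almost monotonicity of \<open>x powr \<alpha> * \<rho> x\<close> bounds \<open>ln (\<rho> x) - ln (\<rho> y)\<close> from above by
  \<open>\<alpha> * (ln y - ln x)\<close> for \<open>x \<le> y\<close>, and that of \<open>x powr \<beta> / \<rho> x\<close> bounds it from below. The value at
  \<open>0\<close> of a function of the class is arbitrary, hence the restriction to \<open>{0<..l}\<close>.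
\<close>

lemma class_WW_eq_exp:
  assumes "\<rho> \<in> class_WW l"
  obtains L where "L \<in> borel_measurable borel" "coarsely_log_Lipschitz {0<..l} L"
    "\<And>x. x \<in> {0<..l} \<Longrightarrow> \<rho> x = ennreal (exp (L x))"
proof -
  obtain \<alpha> \<beta> f g where f: "f \<in> class_W l" "\<And>x. x \<in> {0<..l} \<Longrightarrow> ennreal (f x) = ennreal (x powr \<alpha>) * \<rho> x"
    and g: "g \<in> class_W l" "\<And>x. x \<in> {0<..l} \<Longrightarrow> ennreal (g x) = ennreal (x powr \<beta>) / \<rho> x"
    using assms unfolding class_WW_def by blast
  define L where "L x = (if x \<in> {0<..l} then ln (f x) - \<alpha> * ln x else 0)" for x
  have pos: "f x > 0" "g x > 0" if "x \<in> {0<..l}" for x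
    using f(1) g(1) that by (auto simp: class_W_def)
  have \<rho>: "\<rho> x = ennreal (exp (L x))" if "x \<in> {0<..l}" for x
  proof -
    have x: "0 < x" using that by auto
    have "ennreal (exp (L x)) = ennreal (x powr - \<alpha> * f x)"
      using pos[OF that] that by (simp add: L_def exp_diff powr_def exp_minus field_simps)
    also have "\<dots> = ennreal (x powr - \<alpha>) * ennreal (f x)"
      using pos[OF that] by (simp add: ennreal_mult)
    also have "\<dots> = ennreal (x powr - \<alpha> * x powr \<alpha>) * \<rho> x"
      unfolding f(2)[OF that] by (simp add: ennreal_mult mult.assoc)
    also have "x powr - \<alpha> * x powr \<alpha> = 1" using x by (simp flip: powr_add)
    finally show ?thesis by simp
  qed
  have ln_g: "ln (g x) = \<beta> * ln x - L x" if "x \<in> {0<..l}" for x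
  proof -
    have "ennreal (g x) = ennreal (x powr \<beta> / exp (L x))"
      unfolding g(2)[OF that] \<rho>[OF that] by (rule divide_ennreal) auto
    then have "g x = x powr \<beta> / exp (L x)"
      using pos[OF that] by (subst (asm) ennreal_inj) auto
    then show ?thesis using that by (simp add: ln_div ln_powr)
  qed
  obtain C where C: "C > 0" "\<And>x y. x \<in> {0<..l} \<Longrightarrow> y \<in> {0<..l} \<Longrightarrow> x \<le> y \<Longrightarrow> f x \<le> C * f y"
    using f(1) by (force simp: class_W_def almost_increasing_on_def)
  obtain D where D: "D > 0" "\<And>x y. x \<in> {0<..l} \<Longrightarrow> y \<in> {0<..l} \<Longrightarrow> x \<le> y \<Longrightarrow> g x \<le> D * g y"
    using g(1) by (force simp: class_W_def almost_increasing_on_def)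
  define A where "A = \<bar>ln C\<bar> + \<bar>ln D\<bar>"
  define B where "B = \<bar>\<alpha>\<bar> + \<bar>\<beta>\<bar>"
  have ordered: "\<bar>L x - L y\<bar> \<le> A + B * \<bar>ln x - ln y\<bar>"
    if xy: "x \<in> {0<..l}" "y \<in> {0<..l}" "x \<le> y" for x y
  proof -
    have "ln (f x) \<le> ln (C * f y)"
      using C(2)[OF xy] C(1) pos xy by (subst ln_le_cancel_iff) auto
    then have up: "L x - L y \<le> ln C + \<alpha> * (ln y - ln x)"
      using C(1) pos[OF xy(2)] xy by (simp add: L_def ln_mult algebra_simps)
    have "ln (g x) \<le> ln (D * g y)"
      using D(2)[OF xy] D(1) pos xy by (subst ln_le_cancel_iff) auto
    then have low: "L y - L x \<le> ln D + \<beta> * (ln y - ln x)"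
      using D(1) pos[OF xy(2)] xy by (simp add: ln_mult ln_g algebra_simps)
    have abs_mult_le: "c * u \<le> \<bar>c\<bar> * \<bar>u\<bar>" for c u :: real
      by (metis abs_ge_self abs_mult)
    have "B * \<bar>ln x - ln y\<bar> = \<bar>\<alpha>\<bar> * \<bar>ln y - ln x\<bar> + \<bar>\<beta>\<bar> * \<bar>ln y - ln x\<bar>"
      by (simp add: B_def algebra_simps abs_minus_commute)
    moreover have "0 \<le> \<bar>\<alpha>\<bar> * \<bar>ln y - ln x\<bar>" "0 \<le> \<bar>\<beta>\<bar> * \<bar>ln y - ln x\<bar>" by auto
    ultimately show ?thesis
      using up low abs_mult_le[of \<alpha> "ln y - ln x"] abs_mult_le[of \<beta> "ln y - ln x"]
      unfolding A_def by linarith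
  qed
  have "\<bar>L x - L y\<bar> \<le> A + B * \<bar>ln x - ln y\<bar>" if "x \<in> {0<..l}" "y \<in> {0<..l}" for x y
    using ordered[of x y] ordered[of y x] that by (metis abs_minus_commute linear)
  moreover have "0 \<le> A" "0 \<le> B" by (auto simp: A_def B_def)
  ultimately have "coarsely_log_Lipschitz {0<..l} L"
    unfolding coarsely_log_Lipschitz_def by blast
  moreover have "L \<in> borel_measurable borel"
  proof -
    have "continuous_on {0<..l} f"
      using f(1) by (auto simp: class_W_def intro: continuous_on_subset)
    then have "continuous_on {0<..l} (\<lambda>x. ln (f x) - \<alpha> * ln x)"
      using pos by (intro continuous_intros) (auto simp: less_imp_neq[symmetric])
    then have "(\<lambda>x. if x \<in> {0<..l} then ln (f x) - \<alpha> * ln x else 0) \<in> borel_measurable borel"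
      by (intro borel_measurable_continuous_on_if) auto
    then show ?thesis by (simp add: L_def[abs_def])
  qed
  ultimately show ?thesis using that \<rho> by blast
qed

section \<open>Means over small portions\<close>

definition portion_mean :: "(real \<Rightarrow> complex) \<Rightarrow> (complex \<Rightarrow> real) \<Rightarrow> complex \<Rightarrow> real \<Rightarrow> real" where
  "portion_mean \<gamma> f t R =
     set_lebesgue_integral (length_measure \<gamma>) (portion \<gamma> t R) f
       / measure (length_measure \<gamma>) (portion \<gamma> t R)"

lemma bounded_near_0_imp_bigo:
  fixes f :: "real \<Rightarrow> real"
  assumes "\<And>R. 0 < R \<Longrightarrow> R \<le> r \<Longrightarrow> \<bar>f R\<bar> \<le> K" "0 < r"
  shows "f \<in> O[at_right 0](\<lambda>_. 1)"
proof (rule bigoI)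
  show "\<forall>\<^sub>F R in at_right 0. norm (f R) \<le> K * norm (1 :: real)"
    unfolding eventually_at_right_field using assms by (intro exI[of _ r]) auto
qed

context Carleson_Jordan_curve
begin

lemma AE_cmod_diff_in_range:
  assumes "t \<in> path_image \<gamma>"
  shows "AE \<tau> in length_measure \<gamma>. cmod (\<tau> - t) \<in> {0<..curve_length \<gamma>}"
  using AE_neq_point[OF assms] AE_space
  by eventually_elim (use cmod_diff_le_length[OF _ assms] in auto)

lemma integrable_coarsely_log_Lipschitz:
  assumes "t \<in> path_image \<gamma>" "L \<in> borel_measurable borel"
    and "coarsely_log_Lipschitz {0<..curve_length \<gamma>} L"
  shows "integrable (length_measure \<gamma>) (\<lambda>\<tau>. L (cmod (\<tau> - t)))"
proof -
  let ?l = "curve_length \<gamma>"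
  obtain A B where "A \<ge> 0" "B \<ge> 0"
    and AB: "\<And>x y. x \<in> {0<..?l} \<Longrightarrow> y \<in> {0<..?l} \<Longrightarrow> \<bar>L x - L y\<bar> \<le> A + B * \<bar>ln x - ln y\<bar>"
    using assms(3) unfolding coarsely_log_Lipschitz_def by blast
  have "integrable (length_measure \<gamma>) (\<lambda>\<tau>. \<bar>L ?l\<bar> + A + B * (\<bar>ln ?l\<bar> + \<bar>ln (cmod (\<tau> - t))\<bar>))"
    using integrable_ln_dist[OF assms(1)] by (intro Bochner_Integration.integrable_add integrable_mult_right integrable_abs) auto
  then show ?thesis
  proof (rule Bochner_Integration.integrable_bound)
    show "(\<lambda>\<tau>. L (cmod (\<tau> - t))) \<in> borel_measurable (length_measure \<gamma>)"
      by (intro borel_measurable_length_measureI measurable_compose[OF _ assms(2)]) measurable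
    show "AE \<tau> in length_measure \<gamma>. norm (L (cmod (\<tau> - t)))
        \<le> norm (\<bar>L ?l\<bar> + A + B * (\<bar>ln ?l\<bar> + \<bar>ln (cmod (\<tau> - t))\<bar>))"
      using AE_cmod_diff_in_range[OF assms(1)]
    proof eventually_elim
      case (elim \<tau>)
      have "B * \<bar>ln (cmod (\<tau> - t)) - ln ?l\<bar> \<le> B * (\<bar>ln ?l\<bar> + \<bar>ln (cmod (\<tau> - t))\<bar>)"
        using \<open>B \<ge> 0\<close> by (intro mult_left_mono) auto
      then have "\<bar>L (cmod (\<tau> - t))\<bar> \<le> \<bar>L ?l\<bar> + A + B * (\<bar>ln ?l\<bar> + \<bar>ln (cmod (\<tau> - t))\<bar>)"
        using AB[OF elim, of ?l] less_le_trans[of 0 "cmod (\<tau> - t)" ?l] elim by auto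
      then show ?case by auto
    qed
  qed
qed

lemma abs_portion_mean_diff_le:
  assumes "integrable (length_measure \<gamma>) f" "set_integrable (length_measure \<gamma>) (portion \<gamma> t R) b"
    and "0 < measure (length_measure \<gamma>) (portion \<gamma> t R)"
    and "AE \<tau> in length_measure \<gamma>. \<tau> \<in> portion \<gamma> t R \<longrightarrow> \<bar>f \<tau> - c\<bar> \<le> b \<tau>"
  shows "\<bar>portion_mean \<gamma> f t R - c\<bar> \<le> portion_mean \<gamma> b t R"
proof -
  let ?M = "length_measure \<gamma>" and ?P = "portion \<gamma> t R"
  have f: "set_integrable ?M ?P f"
    using assms(1) by (auto simp: set_integrable_def intro: integrable_mult_indicator[where 'b = real, simplified])
  have c: "set_integrable ?M ?P (\<lambda>_. c)"
    by (rule set_integrable_const)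
  have "set_lebesgue_integral ?M ?P (\<lambda>\<tau>. f \<tau> - c)
      = set_lebesgue_integral ?M ?P f - measure ?M ?P * c"
    using f c by (simp add: set_integral_diff set_integral_portion_const)
  moreover have "\<bar>set_lebesgue_integral ?M ?P (\<lambda>\<tau>. f \<tau> - c)\<bar> \<le> set_lebesgue_integral ?M ?P b"
  proof -
    have "\<bar>set_lebesgue_integral ?M ?P (\<lambda>\<tau>. f \<tau> - c)\<bar> \<le> (\<integral>\<tau>. \<bar>indicator ?P \<tau> *\<^sub>R (f \<tau> - c)\<bar> \<partial>?M)"
      unfolding set_lebesgue_integral_def by (rule integral_abs_bound)
    also have "\<dots> \<le> set_lebesgue_integral ?M ?P b"
      unfolding set_lebesgue_integral_def
    proof (rule integral_mono_AE)
      show "integrable ?M (\<lambda>\<tau>. \<bar>indicator ?P \<tau> *\<^sub>R (f \<tau> - c)\<bar>)"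
        using set_integral_diff(1)[OF f c] by (intro integrable_abs) (simp add: set_integrable_def)
      show "integrable ?M (\<lambda>\<tau>. indicator ?P \<tau> *\<^sub>R b \<tau>)"
        using assms(2) by (simp add: set_integrable_def)
      show "AE \<tau> in ?M. \<bar>indicator ?P \<tau> *\<^sub>R (f \<tau> - c)\<bar> \<le> indicator ?P \<tau> *\<^sub>R b \<tau>"
        using assms(4) by eventually_elim (auto simp: indicator_def)
    qed
    finally show ?thesis .
  qed
  ultimately show ?thesis
    using assms(3) by (simp add: portion_mean_def field_simps abs_le_iff)
qed

text \<open>
  On the portion of radius \<open>R\<close> the function deviates from its value at distance \<open>R\<close> by at most
  \<open>A + B ln (R / |\<tau> - t|)\<close>, and the mean of the logarithm is bounded since the measure of the
  portion is comparable to \<open>R\<close>.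
\<close>

lemma portion_mean_at_center:
  assumes "t \<in> path_image \<gamma>" "L \<in> borel_measurable borel"
    and "coarsely_log_Lipschitz {0<..curve_length \<gamma>} L"
  shows "(\<lambda>R. portion_mean \<gamma> (\<lambda>\<tau>. L (cmod (\<tau> - t))) t R - L R) \<in> O[at_right 0](\<lambda>_. 1)"
proof -
  let ?M = "length_measure \<gamma>" and ?l = "curve_length \<gamma>"
  obtain A B where "A \<ge> 0" "B \<ge> 0"
    and AB: "\<And>x y. x \<in> {0<..?l} \<Longrightarrow> y \<in> {0<..?l} \<Longrightarrow> \<bar>L x - L y\<bar> \<le> A + B * \<bar>ln x - ln y\<bar>"
    using assms(3) unfolding coarsely_log_Lipschitz_def by blast
  obtain r where r: "0 < r" "\<And>R. 0 < R \<Longrightarrow> R \<le> r \<Longrightarrow> R / 2 \<le> measure ?M (portion \<gamma> t R)"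
    using measure_portion_ge[OF assms(1)] by blast
  obtain C where "C \<ge> 0" and C:
    "\<And>R. 0 < R \<Longrightarrow> set_integrable ?M (portion \<gamma> t R) (\<lambda>\<tau>. ln (R / cmod (\<tau> - t)))"
    "\<And>R. 0 < R \<Longrightarrow> set_lebesgue_integral ?M (portion \<gamma> t R) (\<lambda>\<tau>. ln (R / cmod (\<tau> - t))) \<le> C * R"
    using log_integral_le assms(1) by metis
  have "?l > 0" by (rule curve_length_pos)
  define r' where "r' = min r ?l"
  have "\<bar>portion_mean \<gamma> (\<lambda>\<tau>. L (cmod (\<tau> - t))) t R - L R\<bar> \<le> A + B * (2 * C)"
    if R: "0 < R" "R \<le> r'" for R
  proof -
    have m: "R / 2 \<le> measure ?M (portion \<gamma> t R)" using r(2) R by (simp add: r'_def)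
    have "\<bar>portion_mean \<gamma> (\<lambda>\<tau>. L (cmod (\<tau> - t))) t R - L R\<bar>
        \<le> portion_mean \<gamma> (\<lambda>\<tau>. A + B * ln (R / cmod (\<tau> - t))) t R"
    proof (rule abs_portion_mean_diff_le)
      show "integrable ?M (\<lambda>\<tau>. L (cmod (\<tau> - t)))"
        by (rule integrable_coarsely_log_Lipschitz) fact+
      show "set_integrable ?M (portion \<gamma> t R) (\<lambda>\<tau>. A + B * ln (R / cmod (\<tau> - t)))"
        using C(1)[OF R(1)]
        by (intro set_integral_add set_integrable_mult_right set_integrable_const)
      show "0 < measure ?M (portion \<gamma> t R)" using m R by simp
      show "AE \<tau> in ?M. \<tau> \<in> portion \<gamma> t R \<longrightarrow>
          \<bar>L (cmod (\<tau> - t)) - L R\<bar> \<le> A + B * ln (R / cmod (\<tau> - t))"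
        using AE_cmod_diff_in_range[OF assms(1)]
      proof eventually_elim
        case (elim \<tau>)
        show ?case
        proof
          assume "\<tau> \<in> portion \<gamma> t R"
          then have "cmod (\<tau> - t) < R" by (simp add: portion_def)
          then have "\<bar>ln (cmod (\<tau> - t)) - ln R\<bar> = ln (R / cmod (\<tau> - t))"
            using elim R by (subst ln_div) auto
          then show "\<bar>L (cmod (\<tau> - t)) - L R\<bar> \<le> A + B * ln (R / cmod (\<tau> - t))"
            using AB[OF elim, of R] R by (simp add: r'_def)
        qed
      qed
    qed
    also have "\<dots> = A + B * portion_mean \<gamma> (\<lambda>\<tau>. ln (R / cmod (\<tau> - t))) t R"
    proof -
      have "set_lebesgue_integral ?M (portion \<gamma> t R) (\<lambda>\<tau>. A + B * ln (R / cmod (\<tau> - t)))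
          = measure ?M (portion \<gamma> t R) * A
            + B * set_lebesgue_integral ?M (portion \<gamma> t R) (\<lambda>\<tau>. ln (R / cmod (\<tau> - t)))"
        using C(1)[OF R(1)]
        by (subst set_integral_add(2)) (auto simp: set_integral_portion_const set_integrable_const)
      then show ?thesis using m R by (simp add: portion_mean_def field_simps)
    qed
    also have "portion_mean \<gamma> (\<lambda>\<tau>. ln (R / cmod (\<tau> - t))) t R \<le> C * R / (R / 2)"
      unfolding portion_mean_def using C(2)[OF R(1)] m R \<open>C \<ge> 0\<close> by (intro frac_le) auto
    also have "C * R / (R / 2) = 2 * C" using R by simp
    finally show ?thesis using \<open>B \<ge> 0\<close> by (simp add: mult_left_mono)
  qed
  moreover have "0 < r'" using r(1) \<open>?l > 0\<close> by (simp add: r'_def)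
  ultimately show ?thesis
    by (rule bounded_near_0_imp_bigo)
qed

text \<open>
  On portions of radius at most half the distance from \<open>t\<close> to \<open>s\<close>, the argument of \<open>L\<close> is bounded
  away from \<open>0\<close>, and so \<open>L\<close> stays within a bounded distance of its value at the right end point.
\<close>

lemma portion_mean_off_center:
  assumes "t \<in> path_image \<gamma>" "s \<in> path_image \<gamma>" "s \<noteq> t" "L \<in> borel_measurable borel"
    and "coarsely_log_Lipschitz {0<..curve_length \<gamma>} L"
  shows "portion_mean \<gamma> (\<lambda>\<tau>. L (cmod (\<tau> - s))) t \<in> O[at_right 0](\<lambda>_. 1)"
proof -
  let ?M = "length_measure \<gamma>" and ?l = "curve_length \<gamma>"
  obtain A B where "A \<ge> 0" "B \<ge> 0"
    and AB: "\<And>x y. x \<in> {0<..?l} \<Longrightarrow> y \<in> {0<..?l} \<Longrightarrow> \<bar>L x - L y\<bar> \<le> A + B * \<bar>ln x - ln y\<bar>"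
    using assms(5) unfolding coarsely_log_Lipschitz_def by blast
  obtain r where r: "0 < r" "\<And>R. 0 < R \<Longrightarrow> R \<le> r \<Longrightarrow> R / 2 \<le> measure ?M (portion \<gamma> t R)"
    using measure_portion_ge[OF assms(1)] by blast
  define d where "d = cmod (s - t)"
  have d: "0 < d" "d \<le> ?l"
    using assms cmod_diff_le_length by (auto simp: d_def)
  define r' where "r' = min r (d / 2)"
  define b where "b = A + B * (ln ?l - ln (d / 2))"
  have "\<bar>portion_mean \<gamma> (\<lambda>\<tau>. L (cmod (\<tau> - s))) t R\<bar> \<le> b + \<bar>L ?l\<bar>" if R: "0 < R" "R \<le> r'" for R
  proof -
    have m: "R / 2 \<le> measure ?M (portion \<gamma> t R)" using r(2) R by (simp add: r'_def)
    have "\<bar>portion_mean \<gamma> (\<lambda>\<tau>. L (cmod (\<tau> - s))) t R - L ?l\<bar> \<le> portion_mean \<gamma> (\<lambda>_. b) t R"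
    proof (rule abs_portion_mean_diff_le)
      show "integrable ?M (\<lambda>\<tau>. L (cmod (\<tau> - s)))"
        by (rule integrable_coarsely_log_Lipschitz) fact+
      show "set_integrable ?M (portion \<gamma> t R) (\<lambda>_. b)"
        by (rule set_integrable_const)
      show "0 < measure ?M (portion \<gamma> t R)" using m R by simp
      show "AE \<tau> in ?M. \<tau> \<in> portion \<gamma> t R \<longrightarrow> \<bar>L (cmod (\<tau> - s)) - L ?l\<bar> \<le> b"
        using AE_cmod_diff_in_range[OF assms(2)]
      proof eventually_elim
        case (elim \<tau>)
        show ?case
        proof
          assume "\<tau> \<in> portion \<gamma> t R"
          then have "cmod (\<tau> - t) < d / 2" using R by (simp add: portion_def r'_def)
          then have "d / 2 \<le> cmod (\<tau> - s)"
            using norm_triangle_ineq[of "s - \<tau>" "\<tau> - t"] by (simp add: d_def norm_minus_commute)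
          then have "ln (d / 2) \<le> ln (cmod (\<tau> - s))" "ln (cmod (\<tau> - s)) \<le> ln ?l"
            using d elim by (auto simp: ln_le_cancel_iff)
          then have "B * \<bar>ln (cmod (\<tau> - s)) - ln ?l\<bar> \<le> B * (ln ?l - ln (d / 2))"
            using \<open>B \<ge> 0\<close> by (intro mult_left_mono) auto
          then show "\<bar>L (cmod (\<tau> - s)) - L ?l\<bar> \<le> b"
            using AB[OF elim, of ?l] d by (simp add: b_def)
        qed
      qed
    qed
    also have "portion_mean \<gamma> (\<lambda>_. b) t R = b"
      using m R by (simp add: portion_mean_def set_integral_portion_const)
    finally show ?thesis by linarith
  qed
  moreover have "0 < r'" using r(1) d by (simp add: r'_def)
  ultimately show ?thesis
    by (rule bounded_near_0_imp_bigo)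
qed

end

section \<open>Indices of subadditive functions\<close>

text \<open>
  This is Fekete's lemma on the half-line: if \<open>\<phi> a / a\<close> is close to the infimum and
  \<open>u = n a + r\<close> with \<open>0 \<le> r < a\<close>, then \<open>\<phi> u \<le> n \<phi> a + \<phi> r\<close>. The bound on \<open>\<phi>\<close> controls \<open>\<phi> r\<close>,
  and applied to large multiples of \<open>u\<close> it shows that the infimum is finite.
\<close>

lemma subadditive_tendsto_INF:
  fixes \<phi> :: "real \<Rightarrow> real"
  assumes sub: "\<And>u v. \<phi> (u + v) \<le> \<phi> u + \<phi> v" and bound: "\<And>u. \<bar>\<phi> u\<bar> \<le> A + B * \<bar>u\<bar>"
    and "0 \<le> B"
  shows "((\<lambda>u. \<phi> u / u) \<longlongrightarrow> (INF u\<in>{0<..}. \<phi> u / u)) at_top"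
proof -
  have multiple: "\<phi> (real (Suc n) * u) \<le> real (Suc n) * \<phi> u" for n u
  proof (induction n)
    case (Suc n)
    have "real (Suc (Suc n)) * u = u + real (Suc n) * u" by (simp add: algebra_simps)
    then have "\<phi> (real (Suc (Suc n)) * u) \<le> \<phi> u + \<phi> (real (Suc n) * u)"
      using sub[of u "real (Suc n) * u"] by simp
    then show ?case using Suc by (simp add: algebra_simps)
  qed simp
  have lower: "- B \<le> \<phi> u / u" if "0 < u" for u
  proof (rule field_le_epsilon)
    fix e :: real assume "0 < e"
    obtain n where "A / (u * e) < real n" using reals_Archimedean2 by blast
    then have "A / (u * e) < real (Suc n)" by simp
    then have "A < real (Suc n) * u * e"
      using that \<open>0 < e\<close> by (simp add: field_simps)
    moreover have "- (A + B * (real (Suc n) * u)) \<le> real (Suc n) * \<phi> u"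
      using multiple[of n u] bound[of "real (Suc n) * u"] that by (simp add: abs_mult)
    ultimately have "0 \<le> real (Suc n) * (\<phi> u + (B + e) * u)"
      by (simp add: algebra_simps)
    then have "0 \<le> \<phi> u + (B + e) * u" by (simp add: zero_le_mult_iff)
    then show "- B \<le> \<phi> u / u + e" using that by (simp add: field_simps)
  qed
  let ?I = "INF u\<in>{0<..}. \<phi> u / u"
  have bdd: "bdd_below ((\<lambda>u. \<phi> u / u) ` {0<..})"
    using lower by (intro bdd_belowI2[of _ "- B"]) auto
  show ?thesis
  proof (rule order_tendstoI)
    fix c assume "c < ?I"
    have "c < \<phi> u / u" if "0 < u" for u
      using cINF_lower[OF bdd, of u] that \<open>c < ?I\<close> by simp
    then show "\<forall>\<^sub>F u in at_top. c < \<phi> u / u"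
      by (rule eventually_mono[OF eventually_gt_at_top[of 0]])
  next
    fix c assume "?I < c"
    then obtain a where a: "0 < a" "\<phi> a / a < c"
      using bdd by (subst (asm) cINF_less_iff) auto
    define q where "q = \<phi> a / a"
    define D where "D = A + B * a + \<bar>q\<bar> * a"
    have upper: "\<phi> u \<le> q * u + D" if "u \<ge> a" for u
    proof -
      define n where "n = nat \<lfloor>u / a\<rfloor> - 1"
      define r where "r = u - real (Suc n) * a"
      have "1 \<le> u / a" using that a by simp
      then have "1 \<le> \<lfloor>u / a\<rfloor>" by simp
      then have n: "real (Suc n) = of_int \<lfloor>u / a\<rfloor>" by (simp add: n_def)
      have "real (Suc n) \<le> u / a" "u / a < real (Suc n) + 1" unfolding n by linarith+
      then have r: "0 \<le> r" "r < a" using a by (auto simp: r_def field_simps)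
      have "\<phi> u \<le> \<phi> (real (Suc n) * a) + \<phi> r"
        using sub[of "real (Suc n) * a" r] by (simp add: r_def)
      also have "\<dots> \<le> real (Suc n) * \<phi> a + (A + B * a)"
      proof (rule add_mono[OF multiple])
        have "B * \<bar>r\<bar> \<le> B * a" using r \<open>0 \<le> B\<close> by (intro mult_left_mono) auto
        then show "\<phi> r \<le> A + B * a" using bound[of r] by linarith
      qed
      also have "real (Suc n) * \<phi> a = q * u - q * r"
        using a by (simp add: q_def r_def field_simps)
      also have "- (q * r) \<le> \<bar>q\<bar> * a"
      proof -
        \<comment> \<open>the sign of \<open>q\<close> is unknown\<close>
        have "- (q * r) \<le> \<bar>q\<bar> * r" using r by (metis abs_ge_minus_self mult_minus_left mult_right_mono)
        also have "\<dots> \<le> \<bar>q\<bar> * a" using r by (intro mult_left_mono) auto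
        finally show ?thesis .
      qed
      then have "q * u - q * r + (A + B * a) \<le> q * u + D" by (simp add: D_def)
      finally show ?thesis .
    qed
    have "((\<lambda>u. q + D / u) \<longlongrightarrow> q + 0) at_top"
      by (intro tendsto_intros real_tendsto_divide_at_top[OF tendsto_const] filterlim_ident)
    then have "\<forall>\<^sub>F u in at_top. q + D / u < c"
      using a by (intro order_tendstoD) (auto simp: q_def)
    moreover have "\<forall>\<^sub>F u in at_top. a \<le> u" by (rule eventually_ge_at_top)
    ultimately show "\<forall>\<^sub>F u in at_top. \<phi> u / u < c"
    proof eventually_elim
      case (elim u)
      have "\<phi> u / u \<le> (q * u + D) / u"
        using upper[OF elim(2)] elim a by (intro divide_right_mono) auto
      also have "\<dots> = q + D / u" using elim a by (simp add: add_divide_distrib)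
      finally show ?case using elim by simp
    qed
  qed
qed

lemma subadditive_tendsto_SUP:
  fixes \<phi> :: "real \<Rightarrow> real"
  assumes sub: "\<And>u v. \<phi> (u + v) \<le> \<phi> u + \<phi> v" and bound: "\<And>u. \<bar>\<phi> u\<bar> \<le> A + B * \<bar>u\<bar>"
    and "0 \<le> B"
  shows "((\<lambda>u. \<phi> u / u) \<longlongrightarrow> (SUP u\<in>{..<0}. \<phi> u / u)) at_bot"
proof -
  have "((\<lambda>u. \<phi> (- u) / u) \<longlongrightarrow> (INF u\<in>{0<..}. \<phi> (- u) / u)) at_top"
    using sub[of "- u" "- v" for u v] bound[of "- u" for u] \<open>0 \<le> B\<close>
    by (intro subadditive_tendsto_INF[where A = A and B = B]) (auto simp: add.commute)
  then have "((\<lambda>u. - (\<phi> (- u) / u)) \<longlongrightarrow> - (INF u\<in>{0<..}. \<phi> (- u) / u)) at_top"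
    by (rule tendsto_minus)
  moreover have "- (INF u\<in>{0<..}. \<phi> (- u) / u) = (SUP u\<in>{..<0}. \<phi> u / u)"
  proof -
    have "uminus ` {..<0} = {0 :: real<..}"
      by (auto simp: image_iff intro: bexI[of _ "- x" for x])
    then have neg: "{0 :: real<..} = uminus ` {..<0}" ..
    show ?thesis unfolding neg Inf_real_def image_image by simp
  qed
  ultimately show ?thesis
    by (simp add: filterlim_at_bot_mirror)
qed

text \<open>
  In logarithmic coordinates a submultiplicative function is subadditive, and its indices are the
  slopes of this subadditive function at \<open>\<plusminus>\<infinity>\<close>.
\<close>

lemma exp_subadditive_indices:
  fixes \<Phi> :: "real \<Rightarrow> ennreal" and \<phi> :: "real \<Rightarrow> real"
  assumes \<Phi>: "\<And>x. 0 < x \<Longrightarrow> \<Phi> x = ennreal (exp (\<phi> (ln x)))"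
    and sub: "\<And>u v. \<phi> (u + v) \<le> \<phi> u + \<phi> v" and bound: "\<And>u. \<bar>\<phi> u\<bar> \<le> A + B * \<bar>u\<bar>"
    and "0 \<le> B"
  shows "regular \<Phi>" "submultiplicative \<Phi>"
    "((\<lambda>u. \<phi> u / u) \<longlongrightarrow> lower_index \<Phi>) at_bot"
    "((\<lambda>u. \<phi> u / u) \<longlongrightarrow> upper_index \<Phi>) at_top"
proof -
  have pos: "\<forall>x>0. 0 < \<Phi> x" using \<Phi> by simp
  have "\<Phi> x \<le> ennreal (exp (A + B))" if "x \<in> {exp (- 1)<..<exp 1}" for x
  proof -
    have "0 < x" using that exp_gt_zero[of "- 1 :: real"] by (auto simp del: exp_gt_zero intro: order.strict_trans)
    then have "\<bar>ln x\<bar> \<le> 1"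
      using that ln_less_cancel_iff[of x "exp 1"] ln_less_cancel_iff[of "exp (- 1)" x] by auto
    then have "B * \<bar>ln x\<bar> \<le> B" using \<open>0 \<le> B\<close> by (rule mult_left_le)
    then have "\<phi> (ln x) \<le> A + B" using bound[of "ln x"] by linarith
    then show ?thesis using \<Phi>[OF \<open>0 < x\<close>] by (simp add: ennreal_leI)
  qed
  moreover have "{exp (- 1)<..<exp 1} \<subseteq> {0 :: real<..}"
    using exp_gt_zero[of "- 1 :: real"] by (auto simp del: exp_gt_zero intro: order.strict_trans)
  ultimately show "regular \<Phi>"
    unfolding regular_def using pos
    by (intro conjI exI[of _ "{exp (- 1)<..<exp 1}"] exI[of _ "exp (A + B)"]) auto
  show "submultiplicative \<Phi>"
    unfolding submultiplicative_def
  proof (intro conjI pos allI impI)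
    fix x y :: real assume "0 < x" "0 < y"
    then show "\<Phi> (x * y) \<le> \<Phi> x * \<Phi> y"
      using sub[of "ln x" "ln y"]
      by (simp add: \<Phi> ln_mult ennreal_mult[symmetric] exp_add[symmetric] ennreal_leI)
  qed
  have ratio: "log_ratio \<Phi> (exp u) = \<phi> u / u" for u
    by (simp add: log_ratio_def \<Phi>)
  have "x \<in> exp ` {..<0}" if "0 < x" "x < 1" for x :: real
    using that by (intro image_eqI[of _ _ "ln x"]) auto
  then have "{0<..<1} = exp ` {..<0 :: real}" by auto
  then have "lower_index \<Phi> = (SUP u\<in>{..<0}. \<phi> u / u)"
    by (simp add: lower_index_def image_image ratio)
  then show "((\<lambda>u. \<phi> u / u) \<longlongrightarrow> lower_index \<Phi>) at_bot"
    using subadditive_tendsto_SUP[OF sub bound \<open>0 \<le> B\<close>] by simp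
  have "x \<in> exp ` {0<..}" if "1 < x" for x :: real
    using that by (intro image_eqI[of _ _ "ln x"]) auto
  then have "{1<..} = exp ` {0 :: real<..}" by auto
  then have "upper_index \<Phi> = (INF u\<in>{0<..}. \<phi> u / u)"
    by (simp add: upper_index_def image_image ratio)
  then show "((\<lambda>u. \<phi> u / u) \<longlongrightarrow> upper_index \<Phi>) at_top"
    using subadditive_tendsto_INF[OF sub bound \<open>0 \<le> B\<close>] by simp
qed

section \<open>Limits superior of dilation quotients\<close>

text \<open>
  For \<open>g = ln \<circ> \<rho>\<close> this is the function \<open>\<Phi>_\<rho>^0\<close>, and for the logarithmic mean at \<open>t\<close> as a function
  of the radius it is \<open>V_t^0\<close>.
\<close>

definition dilation_limsup :: "(real \<Rightarrow> real) \<Rightarrow> real \<Rightarrow> ennreal" where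
  "dilation_limsup g x = Limsup (at_right 0) (\<lambda>R. ennreal (exp (g (x * R) - g R)))"

definition log_dilation_limsup :: "(real \<Rightarrow> real) \<Rightarrow> real \<Rightarrow> real" where
  "log_dilation_limsup g u = ln (enn2real (dilation_limsup g (exp u)))"

lemma eventually_at_right_0_scale:
  fixes x :: real
  assumes "0 < x" "\<forall>\<^sub>F R in at_right 0. P R"
  shows "\<forall>\<^sub>F R in at_right 0. P (x * R)"
proof -
  obtain b where b: "b > 0" "\<And>R. 0 < R \<Longrightarrow> R < b \<Longrightarrow> P R"
    using assms(2) unfolding eventually_at_right_field by blast
  have "P (x * R)" if "0 < R" "R < b / x" for R
    using b(2)[of "x * R"] that assms(1) by (simp add: field_simps)
  then show ?thesis
    unfolding eventually_at_right_field using b(1) assms(1) by (intro exI[of _ "b / x"]) auto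
qed

lemma coarsely_log_Lipschitz_dilation:
  assumes "0 < \<delta>" "coarsely_log_Lipschitz {0<..\<delta>} g"
  shows "\<exists>A. \<exists>B\<ge>0. \<forall>u. \<forall>\<^sub>F R in at_right 0. \<bar>g (exp u * R) - g R\<bar> \<le> A + B * \<bar>u\<bar>"
proof -
  obtain A B where AB: "0 \<le> B"
    "\<And>x y. x \<in> {0<..\<delta>} \<Longrightarrow> y \<in> {0<..\<delta>} \<Longrightarrow> \<bar>g x - g y\<bar> \<le> A + B * \<bar>ln x - ln y\<bar>"
    using assms(2) unfolding coarsely_log_Lipschitz_def by blast
  have near: "\<forall>\<^sub>F R in at_right 0. R \<in> {0<..\<delta>}"
    unfolding eventually_at_right_field using assms(1) by (intro exI[of _ \<delta>]) auto
  have "\<forall>\<^sub>F R in at_right 0. \<bar>g (exp u * R) - g R\<bar> \<le> A + B * \<bar>u\<bar>" for u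
    using near eventually_at_right_0_scale[OF exp_gt_zero near, of u]
  proof eventually_elim
    case (elim R)
    then show ?case using AB(2)[OF elim(2,1)] by (simp add: ln_mult)
  qed
  then show ?thesis using AB(1) by blast
qed

text \<open>
  A bound on the quotients keeps their limit superior away from \<open>0\<close> and \<open>\<infinity>\<close>, so that it can be
  handled through its real logarithm.
\<close>

lemma dilation_limsup_eq_exp:
  assumes "\<forall>\<^sub>F R in at_right 0. \<bar>g (exp u * R) - g R\<bar> \<le> c"
  shows "dilation_limsup g (exp u) = ennreal (exp (log_dilation_limsup g u))"
    "\<bar>log_dilation_limsup g u\<bar> \<le> c"
proof -
  let ?F = "at_right (0 :: real)"
  have upper: "dilation_limsup g (exp u) \<le> ennreal (exp c)"
    unfolding dilation_limsup_def
    using assms by (intro Limsup_bounded, elim eventually_mono) (simp add: ennreal_leI)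
  have "\<forall>\<^sub>F R in ?F. ennreal (exp (- c)) \<le> ennreal (exp (g (exp u * R) - g R))"
    using assms by eventually_elim (simp add: ennreal_leI)
  then have lower: "ennreal (exp (- c)) \<le> dilation_limsup g (exp u)"
    unfolding dilation_limsup_def by (intro le_Limsup) auto
  obtain d where d: "d \<ge> 0" "dilation_limsup g (exp u) = ennreal d"
    using upper by (cases "dilation_limsup g (exp u)") (auto simp: top_unique)
  have le: "exp (- c) \<le> d" "d \<le> exp c"
    using upper lower d by (auto simp: ennreal_le_iff)
  then have "d > 0" using exp_gt_zero[of "- c"] by linarith
  then show eq: "dilation_limsup g (exp u) = ennreal (exp (log_dilation_limsup g u))"
    using d by (simp add: log_dilation_limsup_def)
  have "ln (exp (- c)) \<le> ln d" "ln d \<le> ln (exp c)"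
    using le \<open>d > 0\<close> by (subst ln_le_cancel_iff; simp)+
  then show "\<bar>log_dilation_limsup g u\<bar> \<le> c"
    using d by (simp add: log_dilation_limsup_def abs_le_iff)
qed

lemma log_dilation_limsup_le:
  assumes "\<forall>\<^sub>F R in at_right 0. \<bar>g (exp u * R) - g R\<bar> \<le> c"
    and "\<forall>\<^sub>F R in at_right 0. g (exp u * R) - g R \<le> d"
  shows "log_dilation_limsup g u \<le> d"
proof -
  have "dilation_limsup g (exp u) \<le> ennreal (exp d)"
    unfolding dilation_limsup_def
    using assms(2) by (intro Limsup_bounded, elim eventually_mono) (simp add: ennreal_leI)
  then show ?thesis unfolding dilation_limsup_eq_exp(1)[OF assms(1)] by (simp add: ennreal_le_iff)
qed

lemma eventually_less_log_dilation_limsup: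
  assumes "\<forall>\<^sub>F R in at_right 0. \<bar>g (exp u * R) - g R\<bar> \<le> c" "0 < e"
  shows "\<forall>\<^sub>F R in at_right 0. g (exp u * R) - g R < log_dilation_limsup g u + e"
proof -
  have "dilation_limsup g (exp u) < ennreal (exp (log_dilation_limsup g u + e))"
    unfolding dilation_limsup_eq_exp(1)[OF assms(1)] using assms(2) by (simp add: ennreal_less_iff)
  then have "\<forall>\<^sub>F R in at_right 0. ennreal (exp (g (exp u * R) - g R))
      < ennreal (exp (log_dilation_limsup g u + e))"
    unfolding dilation_limsup_def by (rule Limsup_lessD)
  then show ?thesis by eventually_elim (simp add: ennreal_less_iff)
qed

text \<open>
  The dilation by \<open>exp (u + v)\<close> splits as
  \<open>g (exp (u + v) * R) - g R = (g (exp u * (exp v * R)) - g (exp v * R)) + (g (exp v * R) - g R)\<close>,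
  and \<open>exp v * R\<close> tends to \<open>0\<close> together with \<open>R\<close>.
\<close>

lemma log_dilation_limsup_subadditive:
  assumes "0 < \<delta>" "coarsely_log_Lipschitz {0<..\<delta>} g"
  shows "log_dilation_limsup g (u + v) \<le> log_dilation_limsup g u + log_dilation_limsup g v"
proof (rule field_le_epsilon)
  fix e :: real assume "0 < e"
  obtain A B where AB: "\<And>u. \<forall>\<^sub>F R in at_right 0. \<bar>g (exp u * R) - g R\<bar> \<le> A + B * \<bar>u\<bar>"
    using coarsely_log_Lipschitz_dilation[OF assms] by blast
  let ?l = "log_dilation_limsup g"
  have "\<forall>\<^sub>F R in at_right 0. g (exp w * R) - g R < ?l w + e / 2" for w
    using AB \<open>0 < e\<close> by (intro eventually_less_log_dilation_limsup) auto
  from this[of v] eventually_at_right_0_scale[OF exp_gt_zero this[of u], of v]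
  have "\<forall>\<^sub>F R in at_right 0. g (exp (u + v) * R) - g R \<le> ?l u + ?l v + e"
    by eventually_elim (simp add: exp_add mult.assoc)
  then show "?l (u + v) \<le> ?l u + ?l v + e"
    by (rule log_dilation_limsup_le[OF AB])
qed

text \<open>The error enters twice, once at \<open>exp u * R\<close> and once at \<open>R\<close>.\<close>

lemma log_dilation_limsup_le_of_bounded_diff:
  assumes "0 < \<delta>" "coarsely_log_Lipschitz {0<..\<delta>} g" "coarsely_log_Lipschitz {0<..\<delta>} h"
    and "\<forall>\<^sub>F R in at_right 0. \<bar>g R - h R\<bar> \<le> K"
  shows "log_dilation_limsup g u \<le> log_dilation_limsup h u + 2 * K"
proof (rule field_le_epsilon)
  fix e :: real assume "0 < e"
  obtain A B where AB: "\<And>u. \<forall>\<^sub>F R in at_right 0. \<bar>g (exp u * R) - g R\<bar> \<le> A + B * \<bar>u\<bar>"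
    using coarsely_log_Lipschitz_dilation[OF assms(1,2)] by blast
  obtain A' B' where AB': "\<And>u. \<forall>\<^sub>F R in at_right 0. \<bar>h (exp u * R) - h R\<bar> \<le> A' + B' * \<bar>u\<bar>"
    using coarsely_log_Lipschitz_dilation[OF assms(1,3)] by blast
  let ?l = "log_dilation_limsup h"
  have "\<forall>\<^sub>F R in at_right 0. g (exp u * R) - g R \<le> ?l u + 2 * K + e"
    using eventually_less_log_dilation_limsup[OF AB' \<open>0 < e\<close>, of u] assms(4)
      eventually_at_right_0_scale[OF exp_gt_zero assms(4), of u]
    by eventually_elim linarith
  then show "log_dilation_limsup g u \<le> ?l u + 2 * K + e"
    by (rule log_dilation_limsup_le[OF AB])
qed

lemma coarsely_log_Lipschitz_subset:
  "coarsely_log_Lipschitz S g \<Longrightarrow> T \<subseteq> S \<Longrightarrow> coarsely_log_Lipschitz T g"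
  unfolding coarsely_log_Lipschitz_def by (meson subsetD)

lemma coarsely_log_Lipschitz_perturb:
  assumes "coarsely_log_Lipschitz S h" "\<And>x. x \<in> S \<Longrightarrow> \<bar>g x - h x\<bar> \<le> K" "0 \<le> K"
  shows "coarsely_log_Lipschitz S g"
proof -
  obtain A B where AB: "0 \<le> A" "0 \<le> B"
    "\<And>x y. x \<in> S \<Longrightarrow> y \<in> S \<Longrightarrow> \<bar>h x - h y\<bar> \<le> A + B * \<bar>ln x - ln y\<bar>"
    using assms(1) unfolding coarsely_log_Lipschitz_def by blast
  have "\<bar>g x - g y\<bar> \<le> (A + 2 * K) + B * \<bar>ln x - ln y\<bar>" if "x \<in> S" "y \<in> S" for x y
    using AB(3)[OF that] assms(2)[OF that(1)] assms(2)[OF that(2)] by linarith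
  then show ?thesis
    unfolding coarsely_log_Lipschitz_def using AB \<open>0 \<le> K\<close>
    by (intro exI[of _ "A + 2 * K"] exI[of _ B] conjI) auto
qed

text \<open>
  A bounded perturbation of \<open>h\<close> changes the logarithm of the limit superior by a bounded amount,
  which disappears on division by \<open>ln x\<close>.
\<close>

theorem dilation_limsup_indices:
  assumes "0 < l" "coarsely_log_Lipschitz {0<..l} h"
    and "(\<lambda>R. g R - h R) \<in> O[at_right 0](\<lambda>_. 1)"
  shows "regular (dilation_limsup g)" "submultiplicative (dilation_limsup g)"
    "(log_ratio (dilation_limsup h) \<longlongrightarrow> lower_index (dilation_limsup g)) (at_right 0)"
    "(log_ratio (dilation_limsup h) \<longlongrightarrow> upper_index (dilation_limsup g)) at_top"
proof -
  obtain K where K: "0 < K" "\<forall>\<^sub>F R in at_right 0. \<bar>g R - h R\<bar> \<le> K"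
    using assms(3) by (elim landau_o.bigE) auto
  then obtain b where b: "b > 0" "\<And>R. 0 < R \<Longrightarrow> R < b \<Longrightarrow> \<bar>g R - h R\<bar> \<le> K"
    unfolding eventually_at_right_field by blast
  define \<delta> where "\<delta> = min l (b / 2)"
  have "0 < \<delta>" using assms(1) b(1) by (simp add: \<delta>_def)
  have h: "coarsely_log_Lipschitz {0<..\<delta>} h"
    by (rule coarsely_log_Lipschitz_subset[OF assms(2)]) (auto simp: \<delta>_def)
  have g: "coarsely_log_Lipschitz {0<..\<delta>} g"
    using b K(1) by (intro coarsely_log_Lipschitz_perturb[OF h, of g K]) (auto simp: \<delta>_def)
  obtain A B where AB: "0 \<le> B" "\<And>u. \<forall>\<^sub>F R in at_right 0. \<bar>g (exp u * R) - g R\<bar> \<le> A + B * \<bar>u\<bar>"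
    using coarsely_log_Lipschitz_dilation[OF \<open>0 < \<delta>\<close> g] by blast
  have \<Phi>: "dilation_limsup g x = ennreal (exp (log_dilation_limsup g (ln x)))" if "0 < x" for x
    using dilation_limsup_eq_exp(1)[OF AB(2), of "ln x"] that by simp
  note indices = exp_subadditive_indices[of "dilation_limsup g" "log_dilation_limsup g" A B,
      OF \<Phi> log_dilation_limsup_subadditive[OF \<open>0 < \<delta>\<close> g] dilation_limsup_eq_exp(2)[OF AB(2)] AB(1)]
  show "regular (dilation_limsup g)" "submultiplicative (dilation_limsup g)"
    by (rule indices; assumption)+
  let ?d = "\<lambda>u. log_dilation_limsup h u / u - log_dilation_limsup g u / u"
  have "\<forall>\<^sub>F R in at_right 0. \<bar>h R - g R\<bar> \<le> K"
    using K(2) by (simp add: abs_minus_commute)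
  then have close: "\<bar>log_dilation_limsup h u - log_dilation_limsup g u\<bar> \<le> 2 * K" for u
    using log_dilation_limsup_le_of_bounded_diff[OF \<open>0 < \<delta>\<close> g h K(2), of u]
      log_dilation_limsup_le_of_bounded_diff[OF \<open>0 < \<delta>\<close> h g, of K u] by auto
  have d: "norm (?d u) \<le> 2 * K / \<bar>u\<bar>" for u
    using divide_right_mono[OF close[of u], of "\<bar>u\<bar>"]
    by (simp add: diff_divide_distrib[symmetric] abs_divide)
  have "((\<lambda>u. 2 * K / \<bar>u\<bar>) \<longlongrightarrow> 0) at_top"
    by (rule real_tendsto_divide_at_top[OF tendsto_const filterlim_abs_real])
  then have top: "(?d \<longlongrightarrow> 0) at_top"
    by (rule tendsto_rabs_zero_cancel[OF tendsto_sandwich[OF _ _ tendsto_const], rotated -1])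
      (use d in auto)
  have "filterlim (\<lambda>u :: real. \<bar>u\<bar>) at_top at_bot"
    by (simp add: filterlim_at_bot_mirror filterlim_abs_real)
  then have "((\<lambda>u. 2 * K / \<bar>u\<bar>) \<longlongrightarrow> 0) at_bot"
    by (rule real_tendsto_divide_at_top[OF tendsto_const])
  then have bot: "(?d \<longlongrightarrow> 0) at_bot"
    by (rule tendsto_rabs_zero_cancel[OF tendsto_sandwich[OF _ _ tendsto_const], rotated -1])
      (use d in auto)
  have ratio: "log_ratio (dilation_limsup h) x = log_dilation_limsup h (ln x) / ln x" if "0 < x" for x
    using that by (simp add: log_ratio_def log_dilation_limsup_def)
  have "((\<lambda>u. log_dilation_limsup h u / u) \<longlongrightarrow> lower_index (dilation_limsup g)) at_bot"
    using tendsto_add[OF bot indices(3)] by simp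
  from filterlim_compose[OF this ln_at_0]
  show "(log_ratio (dilation_limsup h) \<longlongrightarrow> lower_index (dilation_limsup g)) (at_right 0)"
    by (rule tendsto_cong[THEN iffD1, rotated])
      (auto simp: ratio eventually_at_right_field intro!: exI[of _ 1])
  have "((\<lambda>u. log_dilation_limsup h u / u) \<longlongrightarrow> upper_index (dilation_limsup g)) at_top"
    using tendsto_add[OF top indices(4)] by simp
  from filterlim_compose[OF this ln_at_top]
  show "(log_ratio (dilation_limsup h) \<longlongrightarrow> upper_index (dilation_limsup g)) at_top"
    by (rule tendsto_cong[THEN iffD1, rotated])
      (auto simp: ratio intro: eventually_mono[OF eventually_gt_at_top[of 0]])
qed

section \<open>Product weights and their indices\<close>

lemma Phi0_eq_dilation_limsup:
  assumes "0 < l" "0 < x" "\<And>y. y \<in> {0<..l} \<Longrightarrow> \<rho> y = ennreal (exp (L y))"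
  shows "Phi0 \<rho> x = dilation_limsup L x"
  unfolding Phi0_def dilation_limsup_def
proof (rule Limsup_eq)
  have near: "\<forall>\<^sub>F y in at_right 0. y \<in> {0<..l}"
    unfolding eventually_at_right_field using assms(1) by (intro exI[of _ l]) auto
  show "\<forall>\<^sub>F y in at_right 0. \<rho> (x * y) / \<rho> y = ennreal (exp (L (x * y) - L y))"
    using near eventually_at_right_0_scale[OF assms(2) near]
    by eventually_elim (simp only: assms(3) exp_diff divide_ennreal exp_ge_zero exp_gt_zero)
qed

lemma V0_eq_dilation_limsup: "V0 \<gamma> w t = dilation_limsup (log_mean \<gamma> w t)"
  by (simp add: V0_def H_def dilation_limsup_def exp_diff fun_eq_iff)

lemma MO_index_eqI:
  assumes "0 < l" "\<And>y. y \<in> {0<..l} \<Longrightarrow> \<rho> y = ennreal (exp (L y))"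
  shows "(log_ratio (dilation_limsup L) \<longlongrightarrow> a) (at_right 0) \<Longrightarrow> MO_lower_index \<rho> = a"
    "(log_ratio (dilation_limsup L) \<longlongrightarrow> b) at_top \<Longrightarrow> MO_upper_index \<rho> = b"
proof -
  have eq: "log_ratio (dilation_limsup L) x = log_ratio (Phi0 \<rho>) x" if "0 < x" for x
    using Phi0_eq_dilation_limsup[OF assms(1) that assms(2)] by (simp add: log_ratio_def)
  show "MO_lower_index \<rho> = a" if lim: "(log_ratio (dilation_limsup L) \<longlongrightarrow> a) (at_right 0)"
    unfolding MO_lower_index_def
  proof (rule tendsto_Lim)
    show "(log_ratio (Phi0 \<rho>) \<longlongrightarrow> a) (at_right 0)"
      using lim by (rule tendsto_cong[THEN iffD1, rotated])
        (auto simp: eq eventually_at_right_field intro!: exI[of _ 1])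
  qed simp
  show "MO_upper_index \<rho> = b" if lim: "(log_ratio (dilation_limsup L) \<longlongrightarrow> b) at_top"
    unfolding MO_upper_index_def
  proof (rule tendsto_Lim)
    show "(log_ratio (Phi0 \<rho>) \<longlongrightarrow> b) at_top"
      using lim by (rule tendsto_cong[THEN iffD1, rotated])
        (auto simp: eq intro: eventually_mono[OF eventually_gt_at_top[of 0]])
  qed simp
qed

lemma log_ratio_dilation_limsup_0: "log_ratio (dilation_limsup (\<lambda>_. 0)) = (\<lambda>_. 0)"
  by (simp add: fun_eq_iff log_ratio_def dilation_limsup_def Limsup_const)

context Carleson_Jordan_curve
begin

text \<open>
  The formula for \<open>ln w\<close> fails only at the finitely many points \<open>ts k\<close>, which form a null set;
  measurability of \<open>w\<close> is not affected by its values there.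
\<close>

lemma product_weight:
  fixes L :: "'i \<Rightarrow> real \<Rightarrow> real"
  assumes "finite I" "ts ` I \<subseteq> path_image \<gamma>" and L: "\<And>k. k \<in> I \<Longrightarrow> L k \<in> borel_measurable borel"
    and lip: "\<And>k. k \<in> I \<Longrightarrow> coarsely_log_Lipschitz {0<..curve_length \<gamma>} (L k)"
    and \<rho>: "\<And>k x. k \<in> I \<Longrightarrow> x \<in> {0<..curve_length \<gamma>} \<Longrightarrow> \<rho> k x = ennreal (exp (L k x))"
    and w: "\<And>\<tau>. \<tau> \<in> path_image \<gamma> \<Longrightarrow> w \<tau> = (\<Prod>k\<in>I. \<rho> k (cmod (\<tau> - ts k)))"
  shows "log_integrable_weight \<gamma> w t"
    "log_mean \<gamma> w t R = (\<Sum>k\<in>I. portion_mean \<gamma> (\<lambda>\<tau>. L k (cmod (\<tau> - ts k))) t R)"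
proof -
  let ?M = "length_measure \<gamma>" and ?l = "curve_length \<gamma>"
  let ?S = "\<lambda>\<tau>. \<Sum>k\<in>I. L k (cmod (\<tau> - ts k))"
  have w_exp: "w \<tau> = ennreal (exp (?S \<tau>))" if "\<tau> \<in> path_image \<gamma>" "\<tau> \<notin> ts ` I" for \<tau>
  proof -
    have "cmod (\<tau> - ts k) \<in> {0<..?l}" if "k \<in> I" for k
      using that assms(2) \<open>\<tau> \<in> _\<close> \<open>\<tau> \<notin> _\<close> cmod_diff_le_length[of \<tau> "ts k"] by auto
    then have "w \<tau> = (\<Prod>k\<in>I. ennreal (exp (L k (cmod (\<tau> - ts k)))))"
      unfolding w[OF that(1)] by (intro prod.cong) (auto simp: \<rho>)
    then show ?thesis using \<open>finite I\<close> by (simp add: prod_ennreal exp_sum)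
  qed
  have int: "integrable ?M (\<lambda>\<tau>. L k (cmod (\<tau> - ts k)))" if "k \<in> I" for k
    using that assms(2) by (intro integrable_coarsely_log_Lipschitz L lip) auto
  then have int_S: "integrable ?M ?S" by (intro Bochner_Integration.integrable_sum)
  have "AE \<tau> in ?M. \<forall>k\<in>I. \<tau> \<noteq> ts k"
    using assms(1,2) by (intro AE_finite_allI AE_neq_point) auto
  then have AE_exp: "AE \<tau> in ?M. w \<tau> = ennreal (exp (?S \<tau>))"
    using AE_space by eventually_elim (auto intro!: w_exp)
  have w_meas [measurable]: "w \<in> borel_measurable ?M"
  proof (rule measurable_discrete_difference)
    show "(\<lambda>\<tau>. ennreal (exp (?S \<tau>))) \<in> borel_measurable ?M"
      using borel_measurable_integrable[OF int_S] by measurable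
    show "countable (ts ` I)" using \<open>finite I\<close> by (intro countable_finite finite_imageI)
    show "{\<tau>} \<in> sets ?M" if "\<tau> \<in> ts ` I" for \<tau>
      using Carleson_points_null[OF Carleson] that assms(2) by blast
    show "ennreal (exp (?S \<tau>)) = w \<tau>" if "\<tau> \<in> space ?M" "\<tau> \<notin> ts ` I" for \<tau>
      using w_exp that by simp
  qed auto
  have log_meas [measurable]: "log_fun w \<in> borel_measurable ?M"
    unfolding log_fun_def[abs_def] by measurable
  have log_AE: "AE \<tau> in ?M. log_fun w \<tau> = ?S \<tau>"
    using AE_exp by eventually_elim (simp add: log_fun_def)
  have int_log: "integrable ?M (log_fun w)"
    using int_S by (rule integrable_cong_AE_imp) (use log_meas log_AE in \<open>auto elim: eventually_mono\<close>)
  have "set_integrable ?M (portion \<gamma> t R) (log_fun w)" for R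
    unfolding set_integrable_def by (intro integrable_mult_indicator portion_in_sets int_log)
  moreover have "weight \<gamma> w"
    unfolding weight_def using w_meas AE_exp by (auto elim: eventually_mono)
  ultimately show "log_integrable_weight \<gamma> w t"
    by (simp add: log_integrable_weight_def)
  have "set_lebesgue_integral ?M (portion \<gamma> t R) (log_fun w)
      = (\<integral>\<tau>. (\<Sum>k\<in>I. indicator (portion \<gamma> t R) \<tau> *\<^sub>R L k (cmod (\<tau> - ts k))) \<partial>?M)"
    unfolding set_lebesgue_integral_def
  proof (rule integral_cong_AE)
    show "(\<lambda>\<tau>. indicator (portion \<gamma> t R) \<tau> *\<^sub>R log_fun w \<tau>) \<in> borel_measurable ?M"
      by measurable
    show "(\<lambda>\<tau>. \<Sum>k\<in>I. indicator (portion \<gamma> t R) \<tau> *\<^sub>R L k (cmod (\<tau> - ts k))) \<in> borel_measurable ?M"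
      using int by (intro borel_measurable_sum borel_measurable_scaleR
          borel_measurable_indicator portion_in_sets borel_measurable_integrable) auto
    show "AE \<tau> in ?M. indicator (portion \<gamma> t R) \<tau> *\<^sub>R log_fun w \<tau>
        = (\<Sum>k\<in>I. indicator (portion \<gamma> t R) \<tau> *\<^sub>R L k (cmod (\<tau> - ts k)))"
      using log_AE by eventually_elim (simp add: sum_distrib_left)
  qed
  also have "\<dots> = (\<Sum>k\<in>I. set_lebesgue_integral ?M (portion \<gamma> t R) (\<lambda>\<tau>. L k (cmod (\<tau> - ts k))))"
    unfolding set_lebesgue_integral_def
    by (intro Bochner_Integration.integral_sum integrable_mult_indicator portion_in_sets int)
  finally show "log_mean \<gamma> w t R = (\<Sum>k\<in>I. portion_mean \<gamma> (\<lambda>\<tau>. L k (cmod (\<tau> - ts k))) t R)"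
    by (simp add: log_mean_def portion_mean_def sum_divide_distrib)
qed

lemma log_mean_product_weight_bigo:
  fixes L :: "'i \<Rightarrow> real \<Rightarrow> real"
  assumes "finite I" "ts ` I \<subseteq> path_image \<gamma>" and L: "\<And>k. k \<in> I \<Longrightarrow> L k \<in> borel_measurable borel"
    and lip: "\<And>k. k \<in> I \<Longrightarrow> coarsely_log_Lipschitz {0<..curve_length \<gamma>} (L k)"
    and \<rho>: "\<And>k x. k \<in> I \<Longrightarrow> x \<in> {0<..curve_length \<gamma>} \<Longrightarrow> \<rho> k x = ennreal (exp (L k x))"
    and w: "\<And>\<tau>. \<tau> \<in> path_image \<gamma> \<Longrightarrow> w \<tau> = (\<Prod>k\<in>I. \<rho> k (cmod (\<tau> - ts k)))"
    and "t \<in> path_image \<gamma>"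
  shows "(\<lambda>R. log_mean \<gamma> w t R - (\<Sum>k\<in>I. if ts k = t then L k R else 0)) \<in> O[at_right 0](\<lambda>_. 1)"
proof -
  have "(\<lambda>R. portion_mean \<gamma> (\<lambda>\<tau>. L k (cmod (\<tau> - ts k))) t R - (if ts k = t then L k R else 0))
      \<in> O[at_right 0](\<lambda>_. 1)" if "k \<in> I" for k
  proof (cases "ts k = t")
    case True
    then show ?thesis
      using portion_mean_at_center[OF \<open>t \<in> path_image \<gamma>\<close> L[OF that] lip[OF that]] by simp
  next
    case False
    moreover have "ts k \<in> path_image \<gamma>" using that assms(2) by auto
    ultimately show ?thesis
      using portion_mean_off_center[OF \<open>t \<in> path_image \<gamma>\<close> _ False L[OF that] lip[OF that]] by simp
  qed
  then have "(\<lambda>R. \<Sum>k\<in>I. portion_mean \<gamma> (\<lambda>\<tau>. L k (cmod (\<tau> - ts k))) t R - (if ts k = t then L k R else 0))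
      \<in> O[at_right 0](\<lambda>_. 1)"
    by (rule big_sum_in_bigo)
  moreover have "log_mean \<gamma> w t R = (\<Sum>k\<in>I. portion_mean \<gamma> (\<lambda>\<tau>. L k (cmod (\<tau> - ts k))) t R)" for R
    by (rule product_weight(2)[where \<rho> = \<rho>]) fact+
  ultimately show ?thesis by (simp add: sum_subtractf)
qed

end

theorem theorem2p8:
  fixes \<gamma> :: "real \<Rightarrow> complex" and \<Gamma> :: "complex set"
    and n :: nat and ts :: "nat \<Rightarrow> complex"
    and ws :: "nat \<Rightarrow> real \<Rightarrow> ennreal" and w :: "complex \<Rightarrow> ennreal"
  assumes "Jordan_curve \<gamma>" and "rectifiable \<gamma>" and "Carleson \<gamma>"
    and "\<Gamma> = path_image \<gamma>"
    and "n \<ge> 1" and "ts ` {1..n} \<subseteq> \<Gamma>" and "inj_on ts {1..n}"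
    and "\<And>k. k \<in> {1..n} \<Longrightarrow> ws k \<in> class_WW (curve_length \<gamma>)"
    and "\<And>\<tau>. \<tau> \<in> \<Gamma> \<Longrightarrow> w \<tau> = (\<Prod>k=1..n. ws k (cmod (\<tau> - ts k)))"
  shows "(\<forall>t\<in>\<Gamma>. log_integrable_weight \<gamma> w t \<and> regular (V0 \<gamma> w t) \<and> submultiplicative (V0 \<gamma> w t))
    \<and> (\<forall>k\<in>{1..n}. lower_index (V0 \<gamma> w (ts k)) = MO_lower_index (ws k)
                  \<and> upper_index (V0 \<gamma> w (ts k)) = MO_upper_index (ws k))
    \<and> (\<forall>t\<in>\<Gamma> - ts ` {1..n}. lower_index (V0 \<gamma> w t) = 0 \<and> upper_index (V0 \<gamma> w t) = 0)"
proof -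
  interpret Carleson_Jordan_curve \<gamma>
    using assms(1-3) by unfold_locales
  let ?l = "curve_length \<gamma>"
  have "\<forall>k\<in>{1..n}. \<exists>L. L \<in> borel_measurable borel \<and> coarsely_log_Lipschitz {0<..?l} L \<and>
      (\<forall>x\<in>{0<..?l}. ws k x = ennreal (exp (L x)))"
    using class_WW_eq_exp[OF assms(8)] by metis
  from bchoice[OF this] obtain L where L: "\<And>k. k \<in> {1..n} \<Longrightarrow> L k \<in> borel_measurable borel"
    "\<And>k. k \<in> {1..n} \<Longrightarrow> coarsely_log_Lipschitz {0<..?l} (L k)"
    "\<And>k x. k \<in> {1..n} \<Longrightarrow> x \<in> {0<..?l} \<Longrightarrow> ws k x = ennreal (exp (L k x))"
    by blast
  have ts: "ts ` {1..n} \<subseteq> path_image \<gamma>" using assms(4,6) by simp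
  have w: "\<And>\<tau>. \<tau> \<in> path_image \<gamma> \<Longrightarrow> w \<tau> = (\<Prod>k=1..n. ws k (cmod (\<tau> - ts k)))"
    using assms(4,9) by simp
  have bigo: "(\<lambda>R. log_mean \<gamma> w t R - (\<Sum>j=1..n. if ts j = t then L j R else 0)) \<in> O[at_right 0](\<lambda>_. 1)"
    if "t \<in> path_image \<gamma>" for t
    by (rule log_mean_product_weight_bigo[where \<rho> = ws, OF finite_atLeastAtMost ts]) (rule L w that; assumption?)+
  have zero: "coarsely_log_Lipschitz {0<..?l} (\<lambda>_. 0)"
    unfolding coarsely_log_Lipschitz_def by (intro exI[of _ 0] conjI) auto
  have at: "(\<lambda>R. log_mean \<gamma> w (ts k) R - L k R) \<in> O[at_right 0](\<lambda>_. 1)" if k: "k \<in> {1..n}" for k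
  proof -
    have "(\<Sum>j=1..n. if ts j = ts k then L j R else 0) = L k R" for R
    proof -
      have "(\<Sum>j=1..n. if ts j = ts k then L j R else 0) = (\<Sum>j=1..n. if j = k then L j R else 0)"
        using k inj_on_eq_iff[OF assms(7)] by (intro sum.cong refl if_cong) simp_all
      then show ?thesis using k by simp
    qed
    moreover have "ts k \<in> path_image \<gamma>" using ts k by auto
    ultimately show ?thesis using bigo[of "ts k"] by simp
  qed
  have off: "(\<lambda>R. log_mean \<gamma> w t R - 0) \<in> O[at_right 0](\<lambda>_. 1)" if t: "t \<in> \<Gamma> - ts ` {1..n}" for t
  proof -
    have "(\<Sum>j=1..n. if ts j = t then L j R else 0) = 0" for R
      using t by (intro sum.neutral) auto
    then show ?thesis
      using bigo[of t] t assms(4) by simp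
  qed
  \<comment> \<open>\<open>h = L k\<close> at \<open>ts k\<close>, and \<open>h = 0\<close> elsewhere\<close>
  note indices_at = dilation_limsup_indices[OF curve_length_pos L(2) at, folded V0_eq_dilation_limsup]
  note indices_off = dilation_limsup_indices[OF curve_length_pos zero off, folded V0_eq_dilation_limsup]
  have "regular (V0 \<gamma> w t)" "submultiplicative (V0 \<gamma> w t)" if "t \<in> \<Gamma>" for t
    using indices_at(1,2) indices_off(1,2)[of t] that by (cases "t \<in> ts ` {1..n}"; force)+
  moreover have "log_integrable_weight \<gamma> w t" for t
    by (rule product_weight(1)[where \<rho> = ws, OF finite_atLeastAtMost ts]) (rule L w; assumption)+
  moreover have "lower_index (V0 \<gamma> w (ts k)) = MO_lower_index (ws k)"
      "upper_index (V0 \<gamma> w (ts k)) = MO_upper_index (ws k)" if k: "k \<in> {1..n}" for k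
    using MO_index_eqI(1)[OF curve_length_pos L(3)[OF k] indices_at(3)[OF k k]]
      MO_index_eqI(2)[OF curve_length_pos L(3)[OF k] indices_at(4)[OF k k]] by simp_all
  moreover have "lower_index (V0 \<gamma> w t) = 0" "upper_index (V0 \<gamma> w t) = 0"
    if t: "t \<in> \<Gamma> - ts ` {1..n}" for t
    using indices_off(3,4)[OF t]
    by (auto simp: log_ratio_dilation_limsup_0 tendsto_const_iff)
  ultimately show ?thesis by blast
qed

end
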